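(* Suppose $0<p(n)<1$, $p(n)=o(1)$ and $\varepsilon>0$. Set $d(n)=np(n)$. There exist constants $d_0$ and $\tau>0$ such that, if $d(n)\ge d_0$ and $t(n)\le \tau\ln d$, then asymptotically almost surely \[ (1-\varepsilon)\frac{d}{2\ln d}\le \chi^t(G_{n,p})\le (1+\varepsilon)\frac{d}{2\ln d}. \]
   Context: $G_{n,p}$ denotes the Erdős–Rényi random graph on $\{1,\dots,n\}$ with independent edge probability $p=p(n)$. "Asymptotically almost surely" means with probability tending to $1$ as $n\to\infty$. For a non-negative integer $t$, a vertex set is $t$-dependent if it induces a subgraph of maximum degree at most $t$; $\chi^t(G)$ is the least number of colours in a vertex colouring of $G$ in which each colour class is $t$-dependent. *)

theory Defs
  imports "HOL-Probability.Probability" "HOL-Library.Landau_Symbols"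
begin

text \<open>A simple graph is given by a vertex set and a set of edges, each edge being a two-element
  set of vertices.\<close>

definition all_edges :: "'a set \<Rightarrow> 'a set set" where
  "all_edges V = {e. e \<subseteq> V \<and> card e = 2}"

definition induced_edges :: "'a set set \<Rightarrow> 'a set \<Rightarrow> 'a set set" where
  "induced_edges E S = {e \<in> E. e \<subseteq> S}"

definition degree :: "'a set set \<Rightarrow> 'a \<Rightarrow> nat" where
  "degree E v = card {e \<in> E. v \<in> e}"

text \<open>Intended for finite \<open>S\<close> only, since \<open>card\<close> is 0 on infinite sets.\<close>

definition t_dependent :: "nat \<Rightarrow> 'a set set \<Rightarrow> 'a set \<Rightarrow> bool" where
  "t_dependent t E S \<longleftrightarrow> (\<forall>v\<in>S. degree (induced_edges E S) v \<le> t)"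

definition t_improper_colouring ::
    "nat \<Rightarrow> 'a set \<Rightarrow> 'a set set \<Rightarrow> nat \<Rightarrow> ('a \<Rightarrow> nat) \<Rightarrow> bool" where
  "t_improper_colouring t V E k c \<longleftrightarrow>
     (\<forall>v\<in>V. c v < k) \<and> (\<forall>i<k. t_dependent t E {v \<in> V. c v = i})"

definition t_improper_chromatic :: "nat \<Rightarrow> 'a set \<Rightarrow> 'a set set \<Rightarrow> nat" where
  "t_improper_chromatic t V E = (LEAST k. \<exists>c. t_improper_colouring t V E k c)"

text \<open>The distribution of the edge set of the Erdos--Renyi graph on \<open>{1..n}\<close>; it is meaningful
  for \<open>p\<close> between 0 and 1.\<close>

definition gnp :: "nat \<Rightarrow> real \<Rightarrow> nat set set pmf" where
  "gnp n p = map_pmf (\<lambda>f. {e \<in> all_edges {1..n}. f e})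
     (Pi_pmf (all_edges {1..n}) False (\<lambda>_. bernoulli_pmf p))"

end

theory Submission
  imports Defs "HOL-Real_Asymp.Real_Asymp"
begin

text \<open>
  Lower bound: every colour class is \<open>t\<close>-dependent, and the first moment method shows that no set
  of about \<open>2 * ln d / p\<close> vertices spans as few edges as a \<open>t\<close>-dependent set of this size does.

  Upper bound: it suffices to colour properly. Let \<open>k\<close> exceed \<open>d / (2 * ln d)\<close> by a small factor and
  weight each almost balanced map \<open>c\<close> from the vertices to \<open>k\<close> colours by the inverse of the
  probability that it is a proper colouring. The second moment of the resulting count is an average,
  over pairs \<open>(c, c')\<close>, of \<open>(1 - p)\<close> to the power minus the number of pairs of vertices which are
  monochromatic in both. The balance condition on \<open>c'\<close> may be dropped, since almost every map is
  balanced; then the classes of \<open>c\<close> and the colours of \<open>c'\<close> decouple into \<open>k * k\<close> binomial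
  variables, and Cauchy-Schwarz shows that the random graph is \<open>k\<close>-colourable with probability at
  least \<open>exp (- sqrt d / p) / 2\<close>.

  Exposing the graph vertex by vertex, the number of vertices that have to be removed to make it
  \<open>k\<close>-colourable is so concentrated that this tiny probability forces it to be below
  \<open>4 * n * d powr (- 1/4)\<close> with high probability. Any vertex set that small induces a sparse graph,
  which is coloured greedily with few additional colours.
\<close>

section \<open>Expectations over a random subset\<close>

text \<open>\<open>d\<close> may stay bounded, so no limit in \<open>d\<close> is available: every
  error term has to vanish with \<open>p\<close> alone, while \<open>d0\<close> only makes finitely
  many inequalities true. This is why the second moment method is not expected to give a probability
  near 1. The bound it does give has exponent \<open>sqrt d / p\<close>, which is
  \<open>n / sqrt d\<close>, and this fixes the scale of the rest. With \<open>n\<close> exposure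
  steps, a deviation of order \<open>n * d powr (- 1/4)\<close> also has an exponent of order
  \<open>n / sqrt d\<close>, and the constant 4 makes it the larger one. Sets of that size typically
  span average degree at most of order \<open>d powr (3/4)\<close>, which is negligible against
  \<open>d / ln d\<close>. The weights by inverse probabilities let every map count equally,
  whatever its class sizes. Hence balance is needed only as an upper bound on the classes, and the
  second moment becomes a sum of products of increasing functions of the overlaps. Monotonicity is
  what permits the comparison with independent binomials.\<close>

definition expect :: "real \<Rightarrow> 'e set \<Rightarrow> ('e set \<Rightarrow> real) \<Rightarrow> real" where
  "expect p I f = (\<Sum>F\<in>Pow I. p ^ card F * (1 - p) ^ card (I - F) * f F)"

lemma expect_empty [simp]: "expect p {} f = f {}"
  by (simp add: expect_def)

lemma expect_insert:
  assumes "finite I" "e \<notin> I"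
  shows "expect p (insert e I) f = p * expect p I (\<lambda>F. f (insert e F)) + (1 - p) * expect p I f"
proof -
  have disj: "Pow I \<inter> insert e ` Pow I = {}" using assms by auto
  have inj: "inj_on (insert e) (Pow I)"
    using assms(2) by (intro inj_onI) (metis Diff_insert_absorb PowD in_mono insert_ident)
  have "expect p (insert e I) f =
      (\<Sum>F\<in>Pow I. p ^ card F * (1 - p) ^ card (insert e I - F) * f F) +
      (\<Sum>F\<in>insert e ` Pow I. p ^ card F * (1 - p) ^ card (insert e I - F) * f F)"
    unfolding expect_def Pow_insert using assms disj by (intro sum.union_disjoint) auto
  also have "(\<Sum>F\<in>insert e ` Pow I. p ^ card F * (1 - p) ^ card (insert e I - F) * f F) =
      (\<Sum>F\<in>Pow I. p * (p ^ card F * (1 - p) ^ card (I - F) * f (insert e F)))"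
    unfolding sum.reindex[OF inj] o_def
  proof (intro sum.cong refl)
    fix F assume F: "F \<in> Pow I"
    have "card (insert e F) = Suc (card F)"
      using F assms by (meson PowD card_insert_disjoint finite_subset in_mono)
    moreover have "insert e I - insert e F = I - F" using assms by auto
    ultimately show "p ^ card (insert e F) * (1 - p) ^ card (insert e I - insert e F) * f (insert e F)
        = p * (p ^ card F * (1 - p) ^ card (I - F) * f (insert e F))" by simp
  qed
  also have "(\<Sum>F\<in>Pow I. p ^ card F * (1 - p) ^ card (insert e I - F) * f F) =
      (\<Sum>F\<in>Pow I. (1 - p) * (p ^ card F * (1 - p) ^ card (I - F) * f F))"
  proof (intro sum.cong refl)
    fix F assume F: "F \<in> Pow I"
    have "insert e I - F = insert e (I - F)" using F assms by auto
    hence "card (insert e I - F) = Suc (card (I - F))" using assms by simp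
    thus "p ^ card F * (1 - p) ^ card (insert e I - F) * f F
        = (1 - p) * (p ^ card F * (1 - p) ^ card (I - F) * f F)" by simp
  qed
  finally show ?thesis by (simp add: expect_def sum_distrib_left)
qed

lemma expect_cong: "(\<And>F. F \<subseteq> I \<Longrightarrow> f F = g F) \<Longrightarrow> expect p I f = expect p I g"
  unfolding expect_def by (intro sum.cong) auto

lemma expect_mono:
  assumes "0 \<le> p" "p \<le> 1" "\<And>F. F \<subseteq> I \<Longrightarrow> f F \<le> g F"
  shows "expect p I f \<le> expect p I g"
  unfolding expect_def using assms by (intro sum_mono mult_left_mono) auto

lemma expect_nonneg:
  assumes "0 \<le> p" "p \<le> 1" "\<And>F. F \<subseteq> I \<Longrightarrow> 0 \<le> f F"
  shows "0 \<le> expect p I f"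
  unfolding expect_def using assms by (intro sum_nonneg mult_nonneg_nonneg) auto

lemma expect_add: "expect p I (\<lambda>F. f F + g F) = expect p I f + expect p I g"
  by (simp add: expect_def sum.distrib algebra_simps)

lemma expect_sum: "expect p I (\<lambda>F. \<Sum>x\<in>A. f x F) = (\<Sum>x\<in>A. expect p I (f x))"
  unfolding expect_def by (subst sum.swap) (simp add: sum_distrib_left)

lemma expect_cmult: "expect p I (\<lambda>F. c * f F) = c * expect p I f"
  by (simp add: expect_def sum_distrib_left mult_ac)

lemma expect_cmult_right: "expect p I (\<lambda>F. f F * c) = expect p I f * c"
  using expect_cmult[of p I c f] by (simp add: mult.commute)

lemma expect_const: "finite I \<Longrightarrow> expect p I (\<lambda>_. c) = c"
  by (induction I rule: finite_induct) (auto simp: expect_insert algebra_simps)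

text \<open>Fubini for independent blocks of edges.\<close>

lemma expect_Un:
  assumes "finite A" "finite B" "A \<inter> B = {}"
  shows "expect p (A \<union> B) f = expect p B (\<lambda>G. expect p A (\<lambda>F. f (F \<union> G)))"
  using assms(2,3)
proof (induction B arbitrary: f rule: finite_induct)
  case (insert e B)
  have "expect p (A \<union> insert e B) f
      = p * expect p (A \<union> B) (\<lambda>F. f (insert e F)) + (1 - p) * expect p (A \<union> B) f"
    using insert.prems insert.hyps assms(1) expect_insert[of "A \<union> B" e p f] by auto
  also have "\<dots> = expect p (insert e B) (\<lambda>G. expect p A (\<lambda>F. f (F \<union> G)))"
    using insert by (simp add: expect_insert)
  finally show ?case .
qed auto

lemma expect_indep:
  assumes "finite I" "S \<subseteq> I"
  shows "expect p I (\<lambda>F. g (F \<inter> S)) = expect p S g"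
proof -
  have fin: "finite S" "finite (I - S)" using assms finite_subset by auto
  have "expect p I (\<lambda>F. g (F \<inter> S)) = expect p ((I - S) \<union> S) (\<lambda>F. g (F \<inter> S))"
    using assms by (simp add: Un_absorb2)
  also have "\<dots> = expect p S (\<lambda>G. expect p (I - S) (\<lambda>F. g ((F \<union> G) \<inter> S)))"
    using fin by (intro expect_Un) auto
  also have "\<dots> = expect p S (\<lambda>G. expect p (I - S) (\<lambda>F. g G))"
    by (intro expect_cong arg_cong[of _ _ g]) auto
  finally show ?thesis using fin by (simp add: expect_const)
qed

lemma expect_avoid:
  assumes "finite I" "S \<subseteq> I"
  shows "expect p I (\<lambda>F. of_bool (F \<inter> S = {})) = (1 - p) ^ card S"
proof -
  have "finite S" using assms finite_subset by auto
  hence "expect p S (\<lambda>F. of_bool (F = {})) = (1 - p) ^ card S"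
    by (induction S rule: finite_induct) (auto simp: expect_insert expect_const)
  thus ?thesis using expect_indep[OF assms, of p "\<lambda>F. of_bool (F = {})"] by simp
qed

lemma expect_contain:
  assumes "finite I" "S \<subseteq> I"
  shows "expect p I (\<lambda>F. of_bool (S \<subseteq> F)) = p ^ card S"
proof -
  have "expect p I (\<lambda>F. of_bool (S \<subseteq> F)) = expect p I (\<lambda>F. of_bool (S \<subseteq> F \<inter> S))"
    by (intro expect_cong) auto
  also have "\<dots> = expect p S (\<lambda>F. of_bool (S \<subseteq> F))"
    using expect_indep[OF assms, of p "\<lambda>F. of_bool (S \<subseteq> F)"] by simp
  also have "\<dots> = (\<Sum>F\<in>Pow S. if F = S then p ^ card S else 0)"
    unfolding expect_def by (intro sum.cong) auto
  also have "\<dots> = p ^ card S" using assms finite_subset by (subst sum.delta) auto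
  finally show ?thesis .
qed

lemma expect_exp_card:
  assumes "finite I" "S \<subseteq> I"
  shows "expect p I (\<lambda>F. z ^ card (F \<inter> S)) = (1 - p + p * z) ^ card S"
proof -
  have "finite S" using assms finite_subset by auto
  hence "expect p S (\<lambda>F. z ^ card F) = (1 - p + p * z) ^ card S"
  proof (induction S rule: finite_induct)
    case (insert e S)
    have "expect p S (\<lambda>F. z ^ card (insert e F)) = expect p S (\<lambda>F. z * z ^ card F)"
    proof (intro expect_cong)
      fix F assume "F \<subseteq> S"
      hence "finite F" "e \<notin> F" using insert.hyps finite_subset by auto
      thus "z ^ card (insert e F) = z * z ^ card F" by simp
    qed
    thus ?case using insert by (simp add: expect_insert expect_cmult algebra_simps)
  qed simp
  thus ?thesis using expect_indep[OF assms, of p "\<lambda>F. z ^ card F"] by simp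
qed

lemma expect_Cauchy_Schwarz:
  assumes "finite I" "0 \<le> p" "p \<le> 1"
  shows "(expect p I (\<lambda>F. f F * g F))\<^sup>2 \<le> expect p I (\<lambda>F. (f F)\<^sup>2) * expect p I (\<lambda>F. (g F)\<^sup>2)"
proof -
  define w where "w = (\<lambda>F. p ^ card F * (1 - p) ^ card (I - F))"
  have w: "w F \<ge> 0" for F unfolding w_def using assms by auto
  have "(\<Sum>F\<in>Pow I. (sqrt (w F) * f F) * (sqrt (w F) * g F))\<^sup>2
      \<le> (\<Sum>F\<in>Pow I. (sqrt (w F) * f F)\<^sup>2) * (\<Sum>F\<in>Pow I. (sqrt (w F) * g F)\<^sup>2)"
    by (rule Cauchy_Schwarz_ineq_sum)
  moreover have "(sqrt (w F) * f F) * (sqrt (w F) * g F) = w F * (f F * g F)" for F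
    using w[of F] by (metis (no_types, lifting) mult.commute mult.left_commute real_sqrt_mult_self abs_of_nonneg)
  ultimately show ?thesis
    using w by (simp add: expect_def power_mult_distrib) (simp add: w_def)
qed

text \<open>Links the product measure to \<open>expect\<close>, whose explicit weights allow
  induction on the index set, one edge at a time.\<close>

lemma prob_gnp:
  assumes "0 \<le> p" "p \<le> 1"
  shows "measure_pmf.prob (gnp n p) A = expect p (all_edges {1..n}) (\<lambda>F. of_bool (F \<in> A))"
proof -
  define I where "I = all_edges {1..n}"
  have fin: "finite I" unfolding I_def all_edges_def by (rule finite_subset[of _ "Pow {1..n}"]) auto
  define P where "P = Pi_pmf I False (\<lambda>_. bernoulli_pmf p)"
  \<comment> \<open>\<open>h\<close> takes indicator functions and inverts, on functions that are
    false outside \<open>I\<close>, the map from indicators to edge sets in \<open>gnp\<close>. The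
    default value \<open>False\<close> confines the support to such functions.\<close>
  define h where "h = (\<lambda>F e. (e::nat set) \<in> (F :: nat set set))"
  have inj: "inj_on h X" for X unfolding h_def by (intro inj_onI) (metis (no_types) Collect_mem_eq)
  have supp: "set_pmf P \<subseteq> h ` Pow I"
  proof
    fix f assume "f \<in> set_pmf P"
    hence "f x = False" if "x \<notin> I" for x
      using that set_Pi_pmf_subset[OF fin, of False] unfolding P_def by blast
    hence "f = h {e. f e}" "{e. f e} \<subseteq> I" by (auto simp: h_def)
    thus "f \<in> h ` Pow I" by auto
  qed
  have pmfh: "pmf P (h F) = p ^ card F * (1 - p) ^ card (I - F)" if "F \<subseteq> I" for F
  proof -
    have "pmf P (h F) = (\<Prod>x\<in>I. pmf (bernoulli_pmf p) (h F x))"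
      unfolding P_def using fin that by (subst pmf_Pi) (auto simp: h_def)
    also have "\<dots> = (\<Prod>x\<in>I. if x \<in> F then p else 1 - p)"
      using assms by (intro prod.cong) (auto simp: h_def)
    also have "\<dots> = p ^ card F * (1 - p) ^ card (I - F)"
      using fin that by (subst prod.If_cases) (auto simp: Int_absorb1 Diff_eq)
    finally show ?thesis .
  qed
  have "measure_pmf.prob (gnp n p) A = measure_pmf.prob P {f. {e \<in> I. f e} \<in> A}"
    unfolding gnp_def I_def[symmetric] P_def[symmetric] by (simp add: vimage_def)
  also have "\<dots> = measure_pmf.prob P ({f. {e \<in> I. f e} \<in> A} \<inter> h ` Pow I)"
    using supp by (intro measure_prob_cong_0) (auto simp: set_pmf_iff)
  also have "{f. {e \<in> I. f e} \<in> A} \<inter> h ` Pow I = h ` (Pow I \<inter> A)"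
  proof -
    have "{e \<in> I. h F e} = F" if "F \<subseteq> I" for F using that by (auto simp: h_def)
    thus ?thesis by auto
  qed
  also have "measure_pmf.prob P (h ` (Pow I \<inter> A)) = (\<Sum>F\<in>Pow I \<inter> A. pmf P (h F))"
    using fin by (subst measure_measure_pmf_finite) (auto simp: sum.reindex[OF inj])
  also have "\<dots> = (\<Sum>F\<in>Pow I \<inter> A. p ^ card F * (1 - p) ^ card (I - F))"
    by (intro sum.cong) (auto simp: pmfh)
  also have "\<dots> = expect p I (\<lambda>F. of_bool (F \<in> A))"
    unfolding expect_def using fin by (intro sum.mono_neutral_cong_left) auto
  finally show ?thesis unfolding I_def .
qed

section \<open>Concentration for functions of independent blocks\<close>

lemma add_inverse_le_two_cosh:
  assumes "0 < z" "z \<le> exp \<theta>" "1 / z \<le> exp (\<theta>::real)"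
  shows "z + 1 / z \<le> 2 * cosh \<theta>"
proof -
  \<comment> \<open>Between \<open>exp (- \<theta>)\<close> and \<open>exp \<theta>\<close> the
    convex function \<open>z + 1 / z\<close> is largest at the ends; this product expresses it
    without calculus.\<close>
  have "(exp \<theta> - z) * (exp \<theta> - 1 / z) \<ge> 0" using assms by (intro mult_nonneg_nonneg) auto
  hence "exp \<theta> * (z + 1 / z) \<le> exp \<theta> * exp \<theta> + 1" using assms by (simp add: algebra_simps)
  also have "\<dots> = exp \<theta> * (2 * cosh \<theta>)"
    by (simp add: cosh_def algebra_simps flip: exp_add)
  finally show ?thesis by simp
qed

text \<open>Averaging over one block at a time, the quotient of two partial averages lies between
  \<open>exp (- \<theta>)\<close> and \<open>exp \<theta>\<close>, and so the mean of the quotient and its inverse is at most \<open>cosh \<theta>\<close>.\<close>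

lemma expect_exp_blocks:
  fixes B :: "nat \<Rightarrow> 'e set"
  assumes p: "0 \<le> p" "p \<le> 1"
  assumes fin: "\<And>i. i < n \<Longrightarrow> finite (B i)"
  assumes disj: "\<And>i j. i < n \<Longrightarrow> j < n \<Longrightarrow> i \<noteq> j \<Longrightarrow> B i \<inter> B j = {}"
  assumes lip: "\<And>i F F'. i < n \<Longrightarrow> F - B i = F' - B i \<Longrightarrow> f F \<le> f F' + 1"
  assumes \<theta>: "0 \<le> \<theta>"
  shows "expect p (\<Union>i<n. B i) (\<lambda>F. exp (\<theta> * f F)) * expect p (\<Union>i<n. B i) (\<lambda>F. exp (- \<theta> * f F))
      \<le> cosh \<theta> ^ n"
  using fin disj lip
proof (induction n arbitrary: f)
  case 0
  then show ?case by (simp flip: exp_add)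
next
  case (Suc n)
  define I where "I = (\<Union>i<n. B i)"
  have finI: "finite I" and finB: "finite (B n)" using Suc.prems(1) by (auto simp: I_def)
  have "B i \<inter> B n = {}" if "i < n" for i using Suc.prems(2)[of i n] that by simp
  hence dis: "I \<inter> B n = {}" unfolding I_def by blast
  define g where "g = (\<lambda>G. expect p I (\<lambda>F. exp (\<theta> * f (F \<union> G))))"
  define h where "h = (\<lambda>G. expect p I (\<lambda>F. exp (- \<theta> * f (F \<union> G))))"
  \<comment> \<open>Division by \<open>g\<close> follows, and \<open>expect_nonneg\<close> gives
    only the weak inequality; hence the minimum over the finitely many values.\<close>
  have gpos: "g G > 0" for G
  proof -
    define X where "X = (\<lambda>F. exp (\<theta> * f (F \<union> G))) ` Pow I"
    define c where "c = Min X"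
    have X: "finite X" "X \<noteq> {}" unfolding X_def using finI by auto
    have "c \<in> X" unfolding c_def using X by (rule Min_in)
    hence c: "c > 0" unfolding X_def by auto
    have c': "c \<le> exp (\<theta> * f (F \<union> G))" if "F \<subseteq> I" for F
      unfolding c_def using that by (intro Min_le X(1)) (auto simp: X_def)
    have "c = expect p I (\<lambda>_. c)" using finI by (simp add: expect_const)
    also have "\<dots> \<le> g G" unfolding g_def using c' p by (intro expect_mono) auto
    finally show ?thesis using c by simp
  qed
  have gh: "g G * h G \<le> cosh \<theta> ^ n" for G
    unfolding g_def h_def I_def
  proof (intro Suc.IH)
    fix i F F' assume "i < n" "F - B i = F' - B i"
    thus "f (F \<union> G) \<le> f (F' \<union> G) + 1"
      by (intro Suc.prems(3)[of i]) (auto simp: Un_Diff)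
  qed (use Suc.prems in auto)
  \<comment> \<open>Two fillings of the last block change \<open>f\<close> by at most 1, whatever
    the other blocks contain.\<close>
  have ratio: "g G \<le> exp \<theta> * g G'" if "G \<subseteq> B n" "G' \<subseteq> B n" for G G'
    unfolding g_def expect_cmult[symmetric]
  proof (intro expect_mono)
    fix F
    have "f (F \<union> G) \<le> f (F \<union> G') + 1"
      using that by (intro Suc.prems(3)[of n]) auto
    hence "\<theta> * f (F \<union> G) \<le> \<theta> + \<theta> * f (F \<union> G')"
      using \<theta> by (metis (no_types) add.commute distrib_left mult.right_neutral mult_left_mono)
    thus "exp (\<theta> * f (F \<union> G)) \<le> exp \<theta> * exp (\<theta> * f (F \<union> G'))"
      by (simp flip: exp_add)
  qed (use p in auto)
  define C where "C = cosh \<theta> ^ n"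
  have C0: "C \<ge> 0" unfolding C_def by (simp add: cosh_real_nonneg)
  have hle: "h G \<le> C * (1 / g G)" for G
    using gh[of G] gpos[of G] by (simp add: C_def field_simps)
  \<comment> \<open>\<open>G\<close> and \<open>G'\<close> are independent copies of the last block,
    so \<open>R\<close> is the mean of \<open>g\<close> times the mean of \<open>1 / g\<close>.
    Exchanging the copies and adding leaves a quotient plus its inverse.\<close>
  define R where "R = expect p (B n) (\<lambda>G. expect p (B n) (\<lambda>G'. g G * (1 / g G')))"
  have R': "R = expect p (B n) g * expect p (B n) (\<lambda>G'. 1 / g G')"
    unfolding R_def expect_cmult expect_cmult_right by (rule refl)
  have R'': "R = expect p (B n) (\<lambda>G. expect p (B n) (\<lambda>G'. g G' * (1 / g G)))"
    unfolding R' expect_cmult expect_cmult_right by (rule refl)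
  have "2 * R = expect p (B n) (\<lambda>G. expect p (B n) (\<lambda>G'. g G * (1 / g G') + g G' * (1 / g G)))"
    unfolding expect_add R''[symmetric] unfolding R_def[symmetric] by simp
  also have "\<dots> \<le> expect p (B n) (\<lambda>G. expect p (B n) (\<lambda>G'. 2 * cosh \<theta>))"
  proof (intro expect_mono p)
    fix G G' assume G: "G \<subseteq> B n" "G' \<subseteq> B n"
    show "g G * (1 / g G') + g G' * (1 / g G) \<le> 2 * cosh \<theta>"
      using add_inverse_le_two_cosh[of "g G / g G'" \<theta>] ratio[OF G] ratio[OF G(2,1)] gpos[of G] gpos[of G']
      by (simp add: field_simps)
  qed
  also have "\<dots> = 2 * cosh \<theta>" using finB by (simp add: expect_const)
  finally have R: "R \<le> cosh \<theta>" by simp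
  have U: "(\<Union>i<Suc n. B i) = I \<union> B n" by (auto simp: I_def less_Suc_eq)
  have "expect p (B n) g * expect p (B n) h \<le> expect p (B n) g * (C * expect p (B n) (\<lambda>G. 1 / g G))"
    unfolding expect_cmult[of p "B n" C, symmetric]
    using p hle gpos by (intro mult_left_mono expect_mono expect_nonneg) (auto intro: less_imp_le)
  also have "\<dots> = C * R" unfolding R' by simp
  also have "\<dots> \<le> C * cosh \<theta>" using R C0 by (intro mult_left_mono)
  finally show ?case
    unfolding U expect_Un[OF finI finB dis] g_def[symmetric] h_def[symmetric] by (simp add: C_def mult.commute)
qed

text \<open>The sharp exponent is half of this; the loss only affects constants. The bound on
  \<open>exp (- x)\<close> follows from the quadratic lower bound on \<open>exp x\<close>, because
  the two quadratics multiply to \<open>1 + x ^ 4 / 4\<close>.\<close>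

lemma cosh_le_exp_square:
  assumes "0 \<le> x" "x \<le> (1::real)"
  shows "cosh x \<le> exp (x\<^sup>2)"
proof -
  have 1: "exp x \<le> 1 + x + x\<^sup>2" using exp_bound[of x] assms by simp
  have "1 \<le> (1 - x + x\<^sup>2 / 2) * (1 + x + x\<^sup>2 / 2)"
    using assms(1) by (simp add: algebra_simps power2_eq_square)
  also have "\<dots> \<le> (1 - x + x\<^sup>2 / 2) * exp x"
    using exp_lower_Taylor_quadratic[of x] assms by (intro mult_left_mono) auto
  finally have 2: "exp (- x) \<le> 1 - x + x\<^sup>2 / 2" by (simp add: exp_minus field_simps)
  have "2 * cosh x \<le> 2 + 2 * x\<^sup>2" using 1 2 by (simp add: cosh_def) (use zero_le_power2[of x] in linarith)
  also have "\<dots> \<le> 2 * exp (x\<^sup>2)" using exp_ge_add_one_self[of "x\<^sup>2"] by linarith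
  finally show ?thesis by simp
qed

section \<open>Colourings\<close>

lemma finite_all_edges: "finite V \<Longrightarrow> finite (all_edges V)"
  unfolding all_edges_def by (rule finite_subset[of _ "Pow V"]) auto

lemma card_all_edges: "finite V \<Longrightarrow> card (all_edges V) = card V choose 2"
  unfolding all_edges_def by (rule n_subsets)

lemma all_edges_mono: "U \<subseteq> V \<Longrightarrow> all_edges U \<subseteq> all_edges V"
  unfolding all_edges_def by auto

definition mono_pairs :: "('a \<Rightarrow> nat) \<Rightarrow> 'a set \<Rightarrow> 'a set set" where
  "mono_pairs c V = {e \<in> all_edges V. \<exists>i. \<forall>v\<in>e. c v = i}"

text \<open>Properness is phrased as avoidance of one fixed edge set, so that the probability that a
  given map is proper is a power of \<open>1 - p\<close> by \<open>expect_avoid\<close>.\<close>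

definition colourable :: "nat \<Rightarrow> 'a set \<Rightarrow> 'a set set \<Rightarrow> bool" where
  "colourable k V F \<longleftrightarrow> (\<exists>c. c ` V \<subseteq> {..<k} \<and> F \<inter> mono_pairs c V = {})"

lemma mono_pairs_subset: "mono_pairs c V \<subseteq> all_edges V"
  by (auto simp: mono_pairs_def)

lemma t_improper_colouring_of_proper:
  assumes "F \<subseteq> all_edges V" "c ` V \<subseteq> {..<k}" "F \<inter> mono_pairs c V = {}"
  shows "t_improper_colouring t V F k c"
proof -
  have "induced_edges F {v \<in> V. c v = i} = {}" for i
  proof (rule equals0I)
    fix e assume "e \<in> induced_edges F {v \<in> V. c v = i}"
    hence e: "e \<in> F" "\<forall>v\<in>e. c v = i" by (auto simp: induced_edges_def)
    hence "e \<in> mono_pairs c V" using assms(1) unfolding mono_pairs_def by blast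
    thus False using assms(3) e by blast
  qed
  thus ?thesis
    using assms(2) by (auto simp: t_improper_colouring_def t_dependent_def degree_def)
qed

lemma t_improper_chromatic_le:
  assumes "F \<subseteq> all_edges V" "colourable k V F"
  shows "t_improper_chromatic t V F \<le> k"
proof -
  obtain c where "c ` V \<subseteq> {..<k}" "F \<inter> mono_pairs c V = {}"
    using assms(2) unfolding colourable_def by auto
  hence "\<exists>c. t_improper_colouring t V F k c"
    using t_improper_colouring_of_proper[OF assms(1)] by (intro exI[of _ c])
  thus ?thesis unfolding t_improper_chromatic_def by (rule Least_le)
qed

text \<open>The \<open>LEAST\<close> is attained only if some number of colours works; an injective
  map with \<open>card V\<close> colours is proper and serves for every \<open>t\<close>.\<close>

lemma t_improper_colouring_chromatic:
  assumes "finite V" "F \<subseteq> all_edges V"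
  obtains c where "t_improper_colouring t V F (t_improper_chromatic t V F) c"
proof -
  obtain c where c: "bij_betw c V {0..<card V}" using assms(1) ex_bij_betw_finite_nat by blast
  have "mono_pairs c V = {}"
  proof (rule equals0I)
    fix e assume "e \<in> mono_pairs c V"
    then obtain i where i: "e \<subseteq> V" "\<forall>v\<in>e. c v = i" "card e = 2"
      unfolding mono_pairs_def all_edges_def by blast
    then obtain u v where "e = {u, v}" "u \<noteq> v" by (auto simp: card_2_iff)
    thus False using i c unfolding bij_betw_def inj_on_def by (metis insertCI subset_eq)
  qed
  hence "t_improper_colouring t V F (card V) c"
    using c assms(2) by (intro t_improper_colouring_of_proper) (auto simp: bij_betw_def)
  hence "\<exists>c. t_improper_colouring t V F (t_improper_chromatic t V F) c"
    unfolding t_improper_chromatic_def by (rule_tac LeastI_ex) blast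
  thus ?thesis using that by auto
qed

lemma colourable_empty: "colourable k {} F"
  by (auto simp: colourable_def mono_pairs_def all_edges_def)

lemma colourable_union:
  assumes "colourable k W F" "colourable k' (V - W) F" "W \<subseteq> V"
  shows "colourable (k + k') V F"
proof -
  obtain c where c: "c ` W \<subseteq> {..<k}" "F \<inter> mono_pairs c W = {}"
    using assms unfolding colourable_def by auto
  obtain c' where c': "c' ` (V - W) \<subseteq> {..<k'}" "F \<inter> mono_pairs c' (V - W) = {}"
    using assms unfolding colourable_def by auto
  define g where "g = (\<lambda>v. if v \<in> W then c v else k + c' v)"
  have "g ` V \<subseteq> {..<k + k'}" using c(1) c'(1) by (auto simp: g_def image_subset_iff trans_less_add1)
  moreover have "e \<notin> F" if em: "e \<in> mono_pairs g V" for e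
  proof -
    obtain i where e: "e \<subseteq> V" "card e = 2" and i: "\<And>v. v \<in> e \<Longrightarrow> g v = i"
      using em unfolding mono_pairs_def all_edges_def by blast
    show ?thesis
    proof (cases "i < k")
      case True
      hence "e \<subseteq> W" using i by (metis g_def not_add_less1 subsetI)
      moreover from this have "\<forall>v\<in>e. c v = i" using i by (metis g_def subsetD)
      ultimately have "e \<in> mono_pairs c W" using e unfolding mono_pairs_def all_edges_def by blast
      thus ?thesis using c by auto
    next
      case False
      have W: "v \<notin> W" if "v \<in> e" for v
      proof
        assume "v \<in> W"
        hence "c v = i" "c v < k" using i[OF that] c(1) by (auto simp: g_def)
        thus False using False by simp
      qed
      have "c' v = i - k" if "v \<in> e" for v using W[OF that] i[OF that] by (simp add: g_def)
      moreover have "e \<subseteq> V - W" using W e by blast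
      ultimately have "e \<in> mono_pairs c' (V - W)"
        using e unfolding mono_pairs_def all_edges_def by blast
      thus ?thesis using c' by auto
    qed
  qed
  ultimately show ?thesis unfolding colourable_def by (intro exI[of _ g]) auto
qed

section \<open>Greedy colouring of sparse graphs\<close>

lemma handshake:
  assumes "finite S" "F \<subseteq> all_edges S"
  shows "(\<Sum>v\<in>S. card {e \<in> F. v \<in> e}) = 2 * card F"
proof -
  have finF: "finite F" using assms finite_all_edges finite_subset by blast
  have "(\<Sum>v\<in>S. card {e \<in> F. v \<in> e}) = (\<Sum>v\<in>S. \<Sum>e\<in>F. of_bool (v \<in> e))"
    using finF by (intro sum.cong) (auto simp: Int_def)
  also have "\<dots> = (\<Sum>e\<in>F. \<Sum>v\<in>S. of_bool (v \<in> e))" by (rule sum.swap)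
  also have "\<dots> = (\<Sum>e\<in>F. 2)"
  proof (intro sum.cong refl)
    fix e assume "e \<in> F"
    hence "e \<subseteq> S" "card e = 2" using assms by (auto simp: all_edges_def)
    thus "(\<Sum>v\<in>S. of_bool (v \<in> e)) = (2::nat)" using assms by (simp add: Int_absorb1)
  qed
  finally show ?thesis by simp
qed

lemma colourable_insert:
  assumes "finite S" "v \<notin> S" "colourable r S F" "F \<subseteq> all_edges V"
    and deg: "card {e \<in> F. e \<subseteq> insert v S \<and> v \<in> e} < r"
  shows "colourable r (insert v S) F"
proof -
  obtain c where c: "c ` S \<subseteq> {..<r}" "F \<inter> mono_pairs c S = {}"
    using assms unfolding colourable_def by auto
  define D where "D = {e \<in> F. e \<subseteq> insert v S \<and> v \<in> e}"
  have finD: "finite D" unfolding D_def using assms(1)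
    by (rule_tac finite_subset[of _ "Pow (insert v S)"]) auto
  define h where "h = (\<lambda>e. c (SOME u. u \<in> e \<and> u \<noteq> v))"
  have "card (h ` D) \<le> card D" using finD by (rule card_image_le)
  hence "card (h ` D) < card {..<r}" using deg by (simp add: D_def)
  hence "\<not> {..<r} \<subseteq> h ` D" using card_mono[of "h ` D" "{..<r}"] finD by auto
  then obtain j where j: "j < r" "j \<notin> h ` D" by auto
  define g where "g = c(v := j)"
  have "e \<notin> F" if em: "e \<in> mono_pairs g (insert v S)" for e
  proof
    assume eF: "e \<in> F"
    obtain i where e: "e \<subseteq> insert v S" "card e = 2" and i: "\<And>u. u \<in> e \<Longrightarrow> g u = i"
      using em unfolding mono_pairs_def all_edges_def by blast
    show False
    proof (cases "v \<in> e")
      case True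
      have "i = j" using i[OF True] by (simp add: g_def)
      obtain u where u: "e = {u, v}" "u \<noteq> v" using e(2) True by (auto simp: card_2_iff)
      have "(SOME w. w \<in> e \<and> w \<noteq> v) = u" using u by (intro some_equality) auto
      hence "h e = j" using i[of u] u \<open>i = j\<close> by (auto simp: h_def g_def)
      moreover have "e \<in> D" using eF e True by (auto simp: D_def)
      ultimately show False using j by auto
    next
      case False
      hence "e \<subseteq> S" using e by blast
      moreover have "c u = i" if "u \<in> e" for u using i[OF that] that False by (auto simp: g_def)
      ultimately have "e \<in> mono_pairs c S" using e unfolding mono_pairs_def all_edges_def by blast
      thus False using c eF by auto
    qed
  qed
  moreover have "g ` insert v S \<subseteq> {..<r}" using c(1) j by (auto simp: g_def)
  ultimately show ?thesis unfolding colourable_def by (intro exI[of _ g]) auto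
qed

text \<open>Degeneracy: average degree below \<open>r\<close> provides a vertex of degree below
  \<open>r\<close>, which is coloured after all the others. The density hypothesis covers all
  subsets because the induction removes vertices one by one.\<close>

lemma colourable_sparse:
  assumes "finite W" "F \<subseteq> all_edges V"
    and sparse: "\<And>S. S \<subseteq> W \<Longrightarrow> S \<noteq> {} \<Longrightarrow> 2 * card {e \<in> F. e \<subseteq> S} < r * card S"
  shows "colourable r W F"
  using assms(1) sparse
proof (induction "card W" arbitrary: W)
  case 0
  thus ?case by (simp add: colourable_empty)
next
  case (Suc m)
  have W: "W \<noteq> {}" "finite W" using Suc by auto
  have "\<exists>v\<in>W. card {e \<in> F. e \<subseteq> W \<and> v \<in> e} < r"
  proof (rule ccontr)
    assume "\<not> ?thesis"
    hence "r * card W \<le> (\<Sum>v\<in>W. card {e \<in> F. e \<subseteq> W \<and> v \<in> e})"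
      using sum_bounded_below[of W r "\<lambda>v. card {e \<in> F. e \<subseteq> W \<and> v \<in> e}"] by (simp add: not_less mult.commute)
    also have "\<dots> = (\<Sum>v\<in>W. card {e \<in> {e \<in> F. e \<subseteq> W}. v \<in> e})"
      by (intro sum.cong arg_cong[of _ _ card]) auto
    also have "\<dots> = 2 * card {e \<in> F. e \<subseteq> W}"
      using W assms(2) by (intro handshake) (auto simp: all_edges_def)
    also have "\<dots> < r * card W" using Suc.prems(2) W by auto
    finally show False by simp
  qed
  then obtain v where v: "v \<in> W" "card {e \<in> F. e \<subseteq> W \<and> v \<in> e} < r" by auto
  have "colourable r (W - {v}) F" using Suc v by (intro Suc.hyps(1)) auto
  hence "colourable r (insert v (W - {v})) F"
    using W v assms(2) by (intro colourable_insert) (auto simp: insert_absorb)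
  thus ?case using v by (simp add: insert_absorb)
qed

section \<open>Heredity and sparsity of \<open>t\<close>-dependent sets\<close>

lemma t_dependent_subset:
  assumes "t_dependent t F S" "U \<subseteq> S" "finite F"
  shows "t_dependent t F U"
  unfolding t_dependent_def
proof
  fix v assume "v \<in> U"
  have "degree (induced_edges F U) v \<le> degree (induced_edges F S) v"
    unfolding degree_def induced_edges_def using assms(2,3) by (intro card_mono finite_Collect_conjI) auto
  also have "\<dots> \<le> t" using assms \<open>v \<in> U\<close> by (auto simp: t_dependent_def)
  finally show "degree (induced_edges F U) v \<le> t" .
qed

lemma t_dependent_card_edges:
  assumes "t_dependent t F S" "finite S" "F \<subseteq> all_edges V"
  shows "card (F \<inter> all_edges S) \<le> t * card S"
proof -
  have eq: "induced_edges F S = F \<inter> all_edges S"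
    using assms(3) by (auto simp: induced_edges_def all_edges_def)
  have "2 * card (F \<inter> all_edges S) = (\<Sum>v\<in>S. degree (induced_edges F S) v)"
    unfolding degree_def eq using assms(2) by (subst handshake) auto
  also have "\<dots> \<le> (\<Sum>v\<in>S. t)" using assms(1) by (intro sum_mono) (auto simp: t_dependent_def)
  finally show ?thesis by (simp add: mult.commute)
qed

text \<open>A pair that is monochromatic for both maps lies in one cell of the common refinement of
  the two partitions.\<close>

lemma card_mono_pairs_Int:
  assumes "finite V" "c ` V \<subseteq> {..<k}" "c' ` V \<subseteq> {..<k}"
  shows "card (mono_pairs c V \<inter> mono_pairs c' V) =
    (\<Sum>i<k. \<Sum>j<k. card {v \<in> V. c v = i \<and> c' v = j} choose 2)"
proof -
  define N where "N = (\<lambda>(i,j). {v \<in> V. c v = i \<and> c' v = j})"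
  have "mono_pairs c V \<inter> mono_pairs c' V = (\<Union>x\<in>{..<k}\<times>{..<k}. all_edges (N x))" (is "?L = ?R")
  proof
    show "?L \<subseteq> ?R"
    proof
      fix e assume "e \<in> ?L"
      then obtain i j where e: "e \<subseteq> V" "card e = 2" "\<forall>v\<in>e. c v = i" "\<forall>v\<in>e. c' v = j"
        unfolding mono_pairs_def all_edges_def by auto
      obtain v where "v \<in> e" using e(2) by fastforce
      hence "v \<in> V" "c v = i" "c' v = j" using e by auto
      hence "i < k" "j < k" using assms(2,3) by auto
      moreover have "e \<in> all_edges (N (i, j))" using e by (auto simp: all_edges_def N_def)
      ultimately show "e \<in> ?R" by auto
    qed
    show "?R \<subseteq> ?L" by (auto simp: mono_pairs_def all_edges_def N_def)
  qed
  moreover have "card ?R = (\<Sum>x\<in>{..<k}\<times>{..<k}. card (all_edges (N x)))"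
  proof (intro card_UN_disjoint)
    show "\<forall>i\<in>{..<k}\<times>{..<k}. finite (all_edges (N i))"
      using assms(1) by (auto simp: N_def intro!: finite_all_edges)
    show "\<forall>x\<in>{..<k}\<times>{..<k}. \<forall>y\<in>{..<k}\<times>{..<k}. x \<noteq> y \<longrightarrow> all_edges (N x) \<inter> all_edges (N y) = {}"
    proof (intro ballI impI equals0I)
      fix x y e assume "x \<noteq> y" "e \<in> all_edges (N x) \<inter> all_edges (N y)"
      hence "e \<subseteq> N x \<inter> N y" "card e = 2" by (auto simp: all_edges_def)
      moreover have "N x \<inter> N y = {}" using \<open>x \<noteq> y\<close> by (cases x; cases y) (auto simp: N_def)
      ultimately show False by auto
    qed
  qed auto
  moreover have "card (all_edges (N x)) = card (N x) choose 2" for x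
    using assms(1) by (intro card_all_edges) (auto simp: N_def split: prod.splits)
  ultimately show ?thesis by (simp add: sum.cartesian_product N_def case_prod_unfold)
qed

section \<open>Averaging over a uniformly random second colouring\<close>

text \<open>A single term \<open>x ^ x / fact x\<close> of the exponential series is at most the sum
  \<open>exp x\<close>, which bounds the factorial from below.\<close>

lemma binomial_le_exp_power:
  assumes "0 < x"
  shows "real (n choose x) \<le> (exp 1 * real n / real x) ^ x"
proof -
  have "real x ^ x / fact x \<le> exp (real x)"
  proof -
    have s: "summable (\<lambda>i. real x ^ i /\<^sub>R fact i)" by (rule summable_exp_generic)
    have "(\<Sum>i\<in>{x}. real x ^ i /\<^sub>R fact i) \<le> (\<Sum>i. real x ^ i /\<^sub>R fact i)"
      by (intro sum_le_suminf s) auto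
    thus ?thesis by (simp add: exp_def divide_inverse mult.commute)
  qed
  hence 1: "real x ^ x \<le> exp 1 ^ x * fact x"
    by (simp add: field_simps flip: exp_of_nat_mult)
  have "real (n choose x) * fact x \<le> real n ^ x"
    using binomial_fact_pow[of n x] by (metis of_nat_fact of_nat_le_iff of_nat_mult of_nat_power)
  hence "real (n choose x) * fact x * real x ^ x \<le> real n ^ x * (exp 1 ^ x * fact x)"
    using 1 by (intro mult_mono) auto
  hence "real (n choose x) * real x ^ x \<le> (exp 1 * real n) ^ x"
    by (simp add: power_mult_distrib mult_ac)
  thus ?thesis using assms by (simp add: power_divide field_simps)
qed

text \<open>The mean of \<open>f\<close> after one increment that happens with probability
  \<open>\<pi>\<close>. The \<open>m\<close>-fold iterate at 0 is thus the mean of \<open>f\<close>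
  under the binomial distribution with \<open>m\<close> trials, but it is easier to handle in
  inductions over vertices.\<close>

definition step_avg :: "real \<Rightarrow> (nat \<Rightarrow> real) \<Rightarrow> nat \<Rightarrow> real" where
  "step_avg \<pi> f x = (1 - \<pi>) * f x + \<pi> * f (Suc x)"

lemma step_avg_mono:
  assumes "0 \<le> \<pi>" "\<pi> \<le> 1" "mono f"
  shows "mono (step_avg \<pi> f)"
  unfolding step_avg_def using assms
  by (intro monoI add_mono mult_left_mono) (auto dest: monoD)

lemma step_avg_nonneg:
  assumes "0 \<le> \<pi>" "\<pi> \<le> 1" "\<And>x. 0 \<le> f x"
  shows "0 \<le> step_avg \<pi> f x"
  unfolding step_avg_def using assms by auto

lemma step_avg_ge:
  assumes "0 \<le> \<pi>" "mono f"
  shows "f x \<le> step_avg \<pi> f x"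
proof -
  have "\<pi> * f x \<le> \<pi> * f (Suc x)" using assms by (intro mult_left_mono) (auto simp: mono_iff_le_Suc)
  thus ?thesis by (simp add: step_avg_def algebra_simps)
qed

lemma funpow_step_avg_mono:
  assumes "0 \<le> \<pi>" "\<pi> \<le> 1" "mono f"
  shows "mono ((step_avg \<pi> ^^ m) f)"
  by (induction m) (auto intro: step_avg_mono assms)

lemma funpow_step_avg_nonneg:
  assumes "0 \<le> \<pi>" "\<pi> \<le> 1" "\<And>x. 0 \<le> f x"
  shows "0 \<le> (step_avg \<pi> ^^ m) f x"
  by (induction m arbitrary: x) (auto intro: step_avg_nonneg assms)

lemma funpow_step_avg_le:
  assumes "0 \<le> \<pi>" "\<pi> \<le> 1" "mono f" "m \<le> n"
  shows "(step_avg \<pi> ^^ m) f x \<le> (step_avg \<pi> ^^ n) f x"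
  using assms(4)
proof (induction n rule: dec_induct)
  case (step n)
  have "(step_avg \<pi> ^^ n) f x \<le> step_avg \<pi> ((step_avg \<pi> ^^ n) f) x"
    using assms by (intro step_avg_ge funpow_step_avg_mono)
  thus ?case using step by simp
qed simp

definition binom_wt :: "real \<Rightarrow> nat \<Rightarrow> nat \<Rightarrow> real" where
  "binom_wt \<pi> m x = real (m choose x) * \<pi> ^ x * (1 - \<pi>) ^ (m - x)"

lemma funpow_step_avg_eq:
  "(step_avg \<pi> ^^ m) f y = (\<Sum>x\<le>m. binom_wt \<pi> m x * f (y + x))"
proof (induction m arbitrary: f)
  case 0
  then show ?case by (simp add: binom_wt_def)
next
  case (Suc m)
  have rec: "binom_wt \<pi> (Suc m) (Suc x) = \<pi> * binom_wt \<pi> m x + (1 - \<pi>) * binom_wt \<pi> m (Suc x)" for x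
  proof (cases "x < m")
    case True
    hence "(1 - \<pi>) ^ (m - x) = (1 - \<pi>) * (1 - \<pi>) ^ (m - Suc x)"
      by (metis Suc_diff_Suc power_Suc)
    thus ?thesis unfolding binom_wt_def by (simp add: distrib_right distrib_left)
  next
    case False
    thus ?thesis by (simp add: binom_wt_def binomial_eq_0 not_less)
  qed
  have rec0: "binom_wt \<pi> (Suc m) 0 = (1 - \<pi>) * binom_wt \<pi> m 0" by (simp add: binom_wt_def)
  have z: "binom_wt \<pi> m (Suc m) = 0" by (simp add: binom_wt_def)
  have "(\<Sum>x\<le>Suc m. binom_wt \<pi> (Suc m) x * f (y + x))
      = (1 - \<pi>) * binom_wt \<pi> m 0 * f y + (\<Sum>x\<le>m. binom_wt \<pi> (Suc m) (Suc x) * f (y + Suc x))"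
    by (subst sum.atMost_Suc_shift) (simp add: rec0)
  also have "\<dots> = (1 - \<pi>) * (binom_wt \<pi> m 0 * f y + (\<Sum>x\<le>m. binom_wt \<pi> m (Suc x) * f (y + Suc x)))
      + \<pi> * (\<Sum>x\<le>m. binom_wt \<pi> m x * f (y + Suc x))"
    by (simp add: rec distrib_left distrib_right sum.distrib sum_distrib_left mult_ac)
  also have "binom_wt \<pi> m 0 * f y + (\<Sum>x\<le>m. binom_wt \<pi> m (Suc x) * f (y + Suc x))
      = (\<Sum>x\<le>Suc m. binom_wt \<pi> m x * f (y + x))"
    by (subst sum.atMost_Suc_shift) simp
  also have "\<dots> = (\<Sum>x\<le>m. binom_wt \<pi> m x * f (y + x))" by (simp add: z)
  also have "(1 - \<pi>) * \<dots> + \<pi> * (\<Sum>x\<le>m. binom_wt \<pi> m x * f (y + Suc x))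
      = (\<Sum>x\<le>m. binom_wt \<pi> m x * step_avg \<pi> f (y + x))"
    by (simp add: step_avg_def distrib_left sum.distrib sum_distrib_left mult_ac)
  also have "\<dots> = (step_avg \<pi> ^^ m) (step_avg \<pi> f) y" by (rule Suc.IH[symmetric])
  finally show ?case by (simp add: funpow_swap1)
qed

lemma binom_wt_nonneg: "0 \<le> \<pi> \<Longrightarrow> \<pi> \<le> 1 \<Longrightarrow> 0 \<le> binom_wt \<pi> m x"
  by (simp add: binom_wt_def)

lemma binom_wt_le:
  assumes "0 \<le> \<pi>" "\<pi> \<le> 1"
  shows "binom_wt \<pi> m x \<le> real (m choose x) * \<pi> ^ x"
proof -
  have "(1 - \<pi>) ^ (m - x) \<le> 1" using assms by (intro power_le_one) auto
  hence "real (m choose x) * \<pi> ^ x * (1 - \<pi>) ^ (m - x) \<le> real (m choose x) * \<pi> ^ x * 1"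
    using assms by (intro mult_left_mono) auto
  thus ?thesis by (simp add: binom_wt_def)
qed

lemma sum_binom_wt_power: "(\<Sum>x\<le>m. binom_wt \<pi> m x * z ^ x) = (1 - \<pi> + \<pi> * z) ^ m"
  using binomial_ring[of "\<pi> * z" "1 - \<pi>" m]
  by (simp add: binom_wt_def power_mult_distrib mult_ac add.commute)

lemma sum_binom_wt: "(\<Sum>x\<le>m. binom_wt \<pi> m x) = 1"
  using sum_binom_wt_power[of \<pi> m 1] by simp

lemma sum_binom_wt_choose_2: "(\<Sum>x\<le>m. binom_wt \<pi> m x * real (x choose 2)) = real (m choose 2) * \<pi>\<^sup>2"
proof -
  \<comment> \<open>The starting point \<open>y\<close> has to be free for the induction, since one
    step also evaluates at \<open>Suc y\<close>.\<close>
  have "(step_avg \<pi> ^^ m) (\<lambda>x. real (x choose 2)) y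
      = real (y choose 2) + real m * \<pi> * real y + real (m choose 2) * \<pi>\<^sup>2" for y
  proof (induction m arbitrary: y)
    case (Suc m)
    have "(step_avg \<pi> ^^ Suc m) (\<lambda>x. real (x choose 2)) y
        = (1 - \<pi>) * (step_avg \<pi> ^^ m) (\<lambda>x. real (x choose 2)) y
          + \<pi> * (step_avg \<pi> ^^ m) (\<lambda>x. real (x choose 2)) (Suc y)"
      by (simp add: step_avg_def)
    also have "\<dots> = real (y choose 2) + real (Suc m) * \<pi> * real y + real (Suc m choose 2) * \<pi>\<^sup>2"
      unfolding Suc.IH by (simp add: numeral_2_eq_2 algebra_simps)
    finally show ?case .
  qed simp
  thus ?thesis using funpow_step_avg_eq[of m \<pi> "\<lambda>x. real (x choose 2)" 0] by (simp add: numeral_2_eq_2)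
qed

text \<open>In the expanded product only the terms with at most one factor \<open>x j\<close> are
  kept; the others are non-negative.\<close>

lemma prod_add_ge:
  fixes a x :: "'i \<Rightarrow> real"
  assumes "finite J" "\<And>j. j \<in> J \<Longrightarrow> 0 \<le> a j" "\<And>j. j \<in> J \<Longrightarrow> 0 \<le> x j"
  shows "(\<Prod>j\<in>J. a j) + (\<Sum>j\<in>J. x j * (\<Prod>i\<in>J - {j}. a i)) \<le> (\<Prod>j\<in>J. a j + x j)"
  using assms
proof (induction J rule: finite_induct)
  case (insert e J)
  have "(\<Sum>j\<in>J. x j * (\<Prod>i\<in>insert e J - {j}. a i)) = (\<Sum>j\<in>J. a e * (x j * (\<Prod>i\<in>J - {j}. a i)))"
  proof (intro sum.cong refl)
    fix j assume "j \<in> J"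
    hence "insert e J - {j} = insert e (J - {j})" using insert.hyps by auto
    thus "x j * (\<Prod>i\<in>insert e J - {j}. a i) = a e * (x j * (\<Prod>i\<in>J - {j}. a i))"
      using insert.hyps by simp
  qed
  hence "(\<Prod>j\<in>insert e J. a j) + (\<Sum>j\<in>insert e J. x j * (\<Prod>i\<in>insert e J - {j}. a i))
      = a e * ((\<Prod>j\<in>J. a j) + (\<Sum>j\<in>J. x j * (\<Prod>i\<in>J - {j}. a i))) + x e * (\<Prod>j\<in>J. a j)"
    using insert.hyps by (simp add: algebra_simps sum_distrib_left)
  also have "\<dots> \<le> a e * (\<Prod>j\<in>J. a j + x j) + x e * (\<Prod>j\<in>J. a j + x j)"
    using insert.prems insert.IH by (intro add_mono mult_left_mono prod_mono) auto
  also have "\<dots> = (\<Prod>j\<in>insert e J. a j + x j)" using insert.hyps by (simp add: algebra_simps)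
  finally show ?case .
qed simp

text \<open>A new vertex raises exactly one of the \<open>k\<close> counters, while the right-hand
  side raises each counter independently with probability \<open>1 / k\<close>. For increasing
  functions independence only adds non-negative terms, those in which several counters rise.\<close>

lemma average_one_step:
  fixes g :: "nat \<Rightarrow> nat \<Rightarrow> real"
  assumes k: "0 < k" and g: "\<And>j. mono (g j)" "\<And>j x. 0 \<le> g j x"
  shows "(\<Sum>y<k. \<Prod>j<k. g j (N j + (if j = y then 1 else 0)))
    \<le> real k * (\<Prod>j<k. step_avg (1 / real k) (g j) (N j))"
proof -
  define a where "a = (\<lambda>j. g j (N j))"
  define b where "b = (\<lambda>j. g j (Suc (N j)) - g j (N j))"
  have a: "0 \<le> a j" and b: "0 \<le> b j" for j
    using g by (auto simp: a_def b_def monoD)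
  have "(\<Prod>j<k. g j (N j + (if j = y then 1 else 0)))
      = (\<Prod>j<k. a j) + b y * (\<Prod>i\<in>{..<k} - {y}. a i)" if y: "y < k" for y
  proof -
    have "(\<Prod>j<k. g j (N j + (if j = y then 1 else 0))) = (a y + b y) * (\<Prod>i\<in>{..<k} - {y}. a i)"
      using y by (subst prod.remove[of _ y]) (auto simp: a_def b_def)
    moreover have "(\<Prod>j<k. a j) = a y * (\<Prod>i\<in>{..<k} - {y}. a i)"
      using y by (subst prod.remove[of _ y]) auto
    ultimately show ?thesis by (simp add: algebra_simps)
  qed
  hence "(\<Sum>y<k. \<Prod>j<k. g j (N j + (if j = y then 1 else 0)))
      = (\<Sum>y<k. (\<Prod>j<k. a j) + b y * (\<Prod>i\<in>{..<k} - {y}. a i))" by simp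
  also have "\<dots> = real k * ((\<Prod>j<k. a j) + (\<Sum>y<k. (b y / real k) * (\<Prod>i\<in>{..<k} - {y}. a i)))"
    using k by (simp add: sum.distrib distrib_left sum_distrib_left)
  also have "\<dots> \<le> real k * (\<Prod>j<k. a j + b j / real k)"
    using a b by (intro mult_left_mono prod_add_ge) auto
  also have "(\<lambda>j. a j + b j / real k) = (\<lambda>j. step_avg (1 / real k) (g j) (N j))"
    using k by (auto simp: a_def b_def step_avg_def field_simps)
  finally show ?thesis by simp
qed

text \<open>For a uniformly random \<open>c'\<close>, the overlaps of one class of \<open>c\<close>
  with the colours of \<open>c'\<close> are multinomial. Products of increasing non-negative
  functions of them have mean at most that for independent binomials with the same marginals;
  vertices are released one at a time.\<close>

lemma colouring_average:
  fixes f :: "nat \<Rightarrow> nat \<Rightarrow> nat \<Rightarrow> real"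
  assumes "finite V" and k: "0 < k" and "c ` V \<subseteq> {..<k}"
    and "\<And>i j. mono (f i j)" and "\<And>i j x. 0 \<le> f i j x"
  shows "(\<Sum>c'\<in>PiE V (\<lambda>_. {..<k}). \<Prod>i<k. \<Prod>j<k. f i j (card {v \<in> V. c v = i \<and> c' v = j}))
    \<le> real k ^ card V * (\<Prod>i<k. \<Prod>j<k. (step_avg (1 / real k) ^^ card {v \<in> V. c v = i}) (f i j) 0)"
  using assms(1,3-5)
proof (induction V arbitrary: f rule: finite_induct)
  case empty
  then show ?case by simp
next
  case (insert v V)
  define \<pi> where "\<pi> = 1 / real k"
  have \<pi>: "0 \<le> \<pi>" "\<pi> \<le> 1" using k by (auto simp: \<pi>_def)
  define i0 where "i0 = c v"
  have i0: "i0 < k" using insert.prems by (auto simp: i0_def)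
  \<comment> \<open>Averaging over the colour of \<open>v\<close> replaces the functions of its row
    by their one-step averages, so the induction hypothesis is needed for other functions than
    \<open>f\<close>.\<close>
  define f' where "f' = (\<lambda>i j. if i = i0 then step_avg \<pi> (f i j) else f i j)"
  define N where "N = (\<lambda>c' i (j::nat). card {u \<in> V. c u = i \<and> c' u = j})"
  have f': "mono (f' i j)" "0 \<le> f' i j x" for i j x
    using insert.prems \<pi> by (auto simp: f'_def intro: step_avg_mono step_avg_nonneg)
  have N: "card {u \<in> insert v V. c u = i \<and> (c'(v := y)) u = j}
      = N c' i j + (if i = i0 \<and> j = y then 1 else 0)" for c' i j y
  proof -
    have "{u \<in> insert v V. c u = i \<and> (c'(v := y)) u = j}
      = (if i = i0 \<and> j = y then insert v {u \<in> V. c u = i \<and> c' u = j} else {u \<in> V. c u = i \<and> c' u = j})"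
      using insert.hyps by (auto simp: i0_def)
    thus ?thesis using insert.hyps by (auto simp: N_def)
  qed
  have step: "(\<Sum>y<k. \<Prod>i<k. \<Prod>j<k. f i j (M i j + (if i = i0 \<and> j = y then 1 else 0)))
      \<le> real k * (\<Prod>i<k. \<Prod>j<k. f' i j (M i j))" for M
  proof -
    define P where "P = (\<Prod>i\<in>{..<k} - {i0}. \<Prod>j<k. f i j (M i j))"
    have P: "0 \<le> P" unfolding P_def by (intro prod_nonneg insert.prems)
    have "(\<Prod>i<k. \<Prod>j<k. f i j (M i j + (if i = i0 \<and> j = y then 1 else 0)))
        = (\<Prod>j<k. f i0 j (M i0 j + (if j = y then 1 else 0))) * P" for y
      using i0 by (subst prod.remove[of _ i0]) (auto simp: P_def)
    hence "(\<Sum>y<k. \<Prod>i<k. \<Prod>j<k. f i j (M i j + (if i = i0 \<and> j = y then 1 else 0)))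
        = (\<Sum>y<k. \<Prod>j<k. f i0 j (M i0 j + (if j = y then 1 else 0))) * P"
      by (simp add: sum_distrib_right)
    also have "\<dots> \<le> real k * (\<Prod>j<k. step_avg \<pi> (f i0 j) (M i0 j)) * P"
      unfolding \<pi>_def using insert.prems by (intro mult_right_mono P average_one_step k) auto
    also have "\<dots> = real k * (\<Prod>i<k. \<Prod>j<k. f' i j (M i j))"
      using i0 by (subst prod.remove[of _ i0]) (auto simp: P_def f'_def)
    finally show ?thesis .
  qed
  let ?Pi = "\<lambda>V. PiE V (\<lambda>_. {..<k})"
  have "(\<Sum>c'\<in>?Pi (insert v V). \<Prod>i<k. \<Prod>j<k. f i j (card {u \<in> insert v V. c u = i \<and> c' u = j}))
      = (\<Sum>(y,c')\<in>{..<k} \<times> ?Pi V. \<Prod>i<k. \<Prod>j<k. f i j (card {u \<in> insert v V. c u = i \<and> (c'(v := y)) u = j}))"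
    unfolding PiE_insert_eq using inj_combinator[OF insert.hyps(2), of "\<lambda>_. {..<k}"]
    by (subst sum.reindex) (auto simp: case_prod_unfold)
  also have "\<dots> = (\<Sum>c'\<in>?Pi V. \<Sum>y<k. \<Prod>i<k. \<Prod>j<k. f i j (N c' i j + (if i = i0 \<and> j = y then 1 else 0)))"
    unfolding N by (subst sum.swap) (simp add: sum.cartesian_product)
  also have "\<dots> \<le> (\<Sum>c'\<in>?Pi V. real k * (\<Prod>i<k. \<Prod>j<k. f' i j (N c' i j)))"
    by (intro sum_mono step)
  also have "\<dots> = real k * (\<Sum>c'\<in>?Pi V. \<Prod>i<k. \<Prod>j<k. f' i j (N c' i j))"
    by (simp add: sum_distrib_left)
  also have "\<dots> \<le> real k * (real k ^ card V *
      (\<Prod>i<k. \<Prod>j<k. (step_avg \<pi> ^^ card {u \<in> V. c u = i}) (f' i j) 0))"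
    unfolding N_def \<pi>_def using insert.prems(1) f' by (intro mult_left_mono insert.IH) auto
  also have "\<dots> = real k ^ card (insert v V) *
      (\<Prod>i<k. \<Prod>j<k. (step_avg \<pi> ^^ card {u \<in> insert v V. c u = i}) (f i j) 0)"
  proof -
    have "(step_avg \<pi> ^^ card {u \<in> V. c u = i}) (f' i j) 0
        = (step_avg \<pi> ^^ card {u \<in> insert v V. c u = i}) (f i j) 0" for i j
    proof (cases "i = i0")
      case True
      hence "{u \<in> insert v V. c u = i} = insert v {u \<in> V. c u = i}" by (auto simp: i0_def)
      hence "card {u \<in> insert v V. c u = i} = Suc (card {u \<in> V. c u = i})"
        using insert.hyps by simp
      thus ?thesis using True by (simp add: f'_def funpow_swap1)
    next
      case False
      hence "{u \<in> insert v V. c u = i} = {u \<in> V. c u = i}" by (auto simp: i0_def)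
      thus ?thesis using False by (simp add: f'_def)
    qed
    thus ?thesis using insert.hyps by simp
  qed
  finally show ?case unfolding \<pi>_def .
qed

section \<open>Second moment\<close>

text \<open>The weighted count \<open>X\<close> vanishes unless the graph is
  \<open>k\<close>-colourable, so Cauchy-Schwarz against the indicator bounds the probability below
  by the squared mean over the second moment. Each map in \<open>Bal\<close> contributes exactly 1
  to the mean.\<close>

lemma second_moment_colourable:
  fixes V :: "'a set"
  assumes V: "finite V" and p: "0 < p" "p < 1" and Q: "0 < Q"
    and Bal: "Bal \<subseteq> PiE V (\<lambda>_. {..<k})"
    and le: "\<And>c. c \<in> Bal \<Longrightarrow>
      (\<Sum>c'\<in>PiE V (\<lambda>_. {..<k}). (1 / (1 - p)) ^ card (mono_pairs c V \<inter> mono_pairs c' V)) \<le> Q"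
  shows "real (card Bal) / Q \<le> expect p (all_edges V) (\<lambda>F. of_bool (colourable k V F))"
proof (cases "Bal = {}")
  case True
  thus ?thesis using p by (auto intro!: expect_nonneg)
next
  case False
  define I where "I = all_edges V"
  define M where "M = (\<lambda>c. mono_pairs c V)"
  have finI: "finite I" using V by (simp add: I_def finite_all_edges)
  have MI: "M c \<subseteq> I" for c by (simp add: M_def I_def mono_pairs_subset)
  have finM: "finite (M c)" for c using MI finI finite_subset by blast
  have finBal: "finite Bal" using Bal V by (rule_tac finite_subset[OF Bal]) (auto intro: finite_PiE)
  define X where "X = (\<lambda>F. \<Sum>c\<in>Bal. (1 / (1 - p)) ^ card (M c) * of_bool (F \<inter> M c = {}))"
  have EX: "expect p I X = real (card Bal)"
    unfolding X_def expect_sum expect_cmult expect_avoid[OF finI MI]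
    using p by (simp flip: power_mult_distrib)
  have "(X F)\<^sup>2 = (\<Sum>c\<in>Bal. \<Sum>c'\<in>Bal. (1 / (1 - p)) ^ card (M c) * (1 / (1 - p)) ^ card (M c')
      * of_bool (F \<inter> (M c \<union> M c') = {}))" for F
    unfolding X_def power2_eq_square sum_product by (intro sum.cong refl) auto
  hence "expect p I (\<lambda>F. (X F)\<^sup>2) = (\<Sum>c\<in>Bal. \<Sum>c'\<in>Bal.
      (1 / (1 - p)) ^ card (M c) * (1 / (1 - p)) ^ card (M c') * (1 - p) ^ card (M c \<union> M c'))"
    using MI finI by (simp add: expect_sum expect_cmult expect_avoid)
  \<comment> \<open>The two weights cancel the probability of avoiding the union, except for the
    common pairs, which are weighted twice.\<close>
  also have "\<dots> = (\<Sum>c\<in>Bal. \<Sum>c'\<in>Bal. (1 / (1 - p)) ^ card (M c \<inter> M c'))"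
  proof (intro sum.cong refl)
    fix c c'
    have "(1 / (1 - p)) ^ card (M c) * (1 / (1 - p)) ^ card (M c') =
        (1 / (1 - p)) ^ card (M c \<union> M c') * (1 / (1 - p)) ^ card (M c \<inter> M c')"
      using card_Un_Int[OF finM finM, of c c'] by (simp flip: power_add)
    thus "(1 / (1 - p)) ^ card (M c) * (1 / (1 - p)) ^ card (M c') * (1 - p) ^ card (M c \<union> M c')
        = (1 / (1 - p)) ^ card (M c \<inter> M c')"
      using p by (simp add: power_divide)
  qed
  also have "\<dots> \<le> (\<Sum>c\<in>Bal. Q)"
  proof (intro sum_mono)
    fix c assume c: "c \<in> Bal"
    have "(\<Sum>c'\<in>Bal. (1 / (1 - p)) ^ card (M c \<inter> M c'))
        \<le> (\<Sum>c'\<in>PiE V (\<lambda>_. {..<k}). (1 / (1 - p)) ^ card (M c \<inter> M c'))"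
      using V Bal p by (intro sum_mono2) (auto intro: finite_PiE)
    also have "\<dots> \<le> Q" unfolding M_def by (rule le[OF c])
    finally show "(\<Sum>c'\<in>Bal. (1 / (1 - p)) ^ card (M c \<inter> M c')) \<le> Q" .
  qed
  finally have EX2: "expect p I (\<lambda>F. (X F)\<^sup>2) \<le> real (card Bal) * Q" by simp
  define P where "P = expect p I (\<lambda>F. of_bool (colourable k V F))"
  have P0: "0 \<le> P" unfolding P_def using p by (intro expect_nonneg) auto
  have X0: "X F * of_bool (colourable k V F) = X F" for F
  proof (cases "colourable k V F")
    case False
    have "F \<inter> M c \<noteq> {}" if "c \<in> Bal" for c
      using False that Bal unfolding colourable_def M_def by (force simp: PiE_iff)
    hence "X F = 0" by (auto simp: X_def)
    thus ?thesis by simp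
  qed simp
  have "(real (card Bal))\<^sup>2 = (expect p I (\<lambda>F. X F * of_bool (colourable k V F)))\<^sup>2"
    unfolding X0 by (simp add: EX)
  also have "\<dots> \<le> expect p I (\<lambda>F. (X F)\<^sup>2) * expect p I (\<lambda>F. (of_bool (colourable k V F))\<^sup>2)"
    using p by (intro expect_Cauchy_Schwarz finI) auto
  also have "\<dots> = expect p I (\<lambda>F. (X F)\<^sup>2) * P"
    by (simp add: P_def of_bool_def if_distrib[of "\<lambda>x. x\<^sup>2"] cong: if_cong)
  also have "\<dots> \<le> real (card Bal) * Q * P" using EX2 P0 by (rule mult_right_mono)
  finally have "real (card Bal) * real (card Bal) \<le> real (card Bal) * (Q * P)"
    by (simp add: power2_eq_square mult_ac)
  moreover have "card Bal > 0" using False finBal by (simp add: card_gt_0_iff)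
  ultimately have "real (card Bal) \<le> Q * P" by simp
  thus ?thesis using Q by (simp add: P_def I_def field_simps)
qed

text \<open>The function of the overlap is increasing, so its binomial mean grows with the number of
  trials and every class may be treated as having \<open>s\<close> vertices.\<close>

lemma colouring_pair_average:
  assumes V: "finite V" and k: "0 < k" and p: "0 < p" "p < 1" and c: "c ` V \<subseteq> {..<k}"
    and s: "\<And>i. i < k \<Longrightarrow> card {v \<in> V. c v = i} \<le> s"
  shows "(\<Sum>c'\<in>PiE V (\<lambda>_. {..<k}). (1 / (1 - p)) ^ card (mono_pairs c V \<inter> mono_pairs c' V))
    \<le> real k ^ card V *
       (\<Sum>x\<le>s. binom_wt (1 / real k) s x * (1 / (1 - p)) ^ (x choose 2)) ^ (k * k)"
proof -
  define z where "z = 1 / (1 - p)"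
  have z: "1 \<le> z" using p by (simp add: z_def field_simps)
  define f where "f = (\<lambda>x::nat. z ^ (x choose 2))"
  define \<pi> where "\<pi> = 1 / real k"
  have \<pi>: "0 \<le> \<pi>" "\<pi> \<le> 1" using k by (auto simp: \<pi>_def)
  have mono_f: "mono f"
    unfolding f_def by (intro monoI power_increasing binomial_right_mono z)
  have f0: "0 \<le> f x" for x using z by (simp add: f_def)
  have "(\<Sum>c'\<in>PiE V (\<lambda>_. {..<k}). z ^ card (mono_pairs c V \<inter> mono_pairs c' V))
     = (\<Sum>c'\<in>PiE V (\<lambda>_. {..<k}). \<Prod>i<k. \<Prod>j<k. f (card {v \<in> V. c v = i \<and> c' v = j}))"
  proof (intro sum.cong refl)
    fix c' assume "c' \<in> PiE V (\<lambda>_. {..<k})"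
    hence "c' ` V \<subseteq> {..<k}" by auto
    thus "z ^ card (mono_pairs c V \<inter> mono_pairs c' V) = (\<Prod>i<k. \<Prod>j<k. f (card {v \<in> V. c v = i \<and> c' v = j}))"
      by (simp add: card_mono_pairs_Int[OF V c] power_sum f_def)
  qed
  also have "\<dots> \<le> real k ^ card V * (\<Prod>i<k. \<Prod>j<k. (step_avg \<pi> ^^ card {v \<in> V. c v = i}) f 0)"
    unfolding \<pi>_def using V k c mono_f f0 by (intro colouring_average) auto
  also have "\<dots> \<le> real k ^ card V * (\<Prod>i<k. \<Prod>j<k. (step_avg \<pi> ^^ s) f 0)"
    using s \<pi> mono_f f0
    by (intro mult_left_mono prod_mono conjI funpow_step_avg_le prod_nonneg funpow_step_avg_nonneg) auto
  also have "\<dots> = real k ^ card V * ((\<Sum>x\<le>s. binom_wt \<pi> s x * f x) ^ (k * k))"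
    by (simp add: funpow_step_avg_eq power_mult)
  finally show ?thesis unfolding z_def \<pi>_def f_def .
qed

text \<open>Union bound over the colours, with a Chernoff bound for each class. A class with more
  than \<open>s\<close> vertices has at least \<open>s + 1\<close>, which is the quantity in the
  hypothesis.\<close>

lemma balanced_colourings:
  fixes V :: "'a set"
  assumes V: "finite V" and k: "0 < k" and \<eta>: "0 < \<eta>" "\<eta> \<le> 1"
    and s: "(1 + \<eta>) * (real (card V) / real k) \<le> real s + 1"
    and small: "real k * exp (- (\<eta>\<^sup>2 * (real (card V) / real k) / 4)) \<le> 1 / 2"
  shows "real k ^ card V / 2 \<le>
    real (card {c \<in> PiE V (\<lambda>_. {..<k}). \<forall>i<k. card {v \<in> V. c v = i} \<le> s})" (is "_ \<le> real (card ?Bal)")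
proof -
  define \<mu> where "\<mu> = real (card V) / real k"
  have \<mu>0: "0 \<le> \<mu>" by (simp add: \<mu>_def)
  define \<Omega> where "\<Omega> = PiE V (\<lambda>_. {..<k})"
  have fin\<Omega>: "finite \<Omega>" using V by (auto simp: \<Omega>_def intro: finite_PiE)
  have card\<Omega>: "real (card \<Omega>) = real k ^ card V" using V by (simp add: \<Omega>_def card_PiE)
  \<comment> \<open>This minimises the exponent
    \<open>\<mu> * (\<theta>\<^sup>2 - \<eta> * \<theta>)\<close> found below.\<close>
  define \<theta> where "\<theta> = \<eta> / 2"
  have \<theta>: "0 < \<theta>" "\<theta> \<le> 1" using \<eta> by (auto simp: \<theta>_def)
  have mgf: "(\<Sum>c\<in>PiE V (\<lambda>_. {..<k}). exp (\<theta> * real (card {v \<in> V. c v = i}))) = (real k - 1 + exp \<theta>) ^ card V"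
    if i: "i < k" for i
  proof -
    have "exp (\<theta> * real (card {v \<in> V. c v = i})) = (\<Prod>v\<in>V. if c v = i then exp \<theta> else 1)" for c
    proof -
      have "(\<Prod>v\<in>V. if c v = i then exp \<theta> else 1) = exp \<theta> ^ card {v \<in> V. c v = i}"
        using V by (subst prod.If_cases) (auto simp: Int_def)
      thus ?thesis by (simp add: mult.commute flip: exp_of_nat_mult)
    qed
    hence "(\<Sum>c\<in>PiE V (\<lambda>_. {..<k}). exp (\<theta> * real (card {v \<in> V. c v = i})))
        = (\<Prod>v\<in>V. \<Sum>j<k. if j = i then exp \<theta> else 1)"
      using V by (subst prod_sum_PiE) auto
    also have "(\<Sum>j<k. if j = i then exp \<theta> else 1) = real k - 1 + exp \<theta>"
      using i by (subst sum.remove[of _ i]) (auto simp: of_nat_diff)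
    finally show ?thesis by simp
  qed
  have bad: "real (card {c \<in> \<Omega>. s < card {v \<in> V. c v = i}}) \<le> real k ^ card V * exp (- (\<eta>\<^sup>2 * \<mu> / 4))"
    if i: "i < k" for i
  proof -
    have "real (card {c \<in> \<Omega>. s < card {v \<in> V. c v = i}}) * exp (\<theta> * ((1 + \<eta>) * \<mu>))
        = (\<Sum>c\<in>{c \<in> \<Omega>. s < card {v \<in> V. c v = i}}. exp (\<theta> * ((1 + \<eta>) * \<mu>)))" by simp
    also have "\<dots> \<le> (\<Sum>c\<in>{c \<in> \<Omega>. s < card {v \<in> V. c v = i}}. exp (\<theta> * real (card {v \<in> V. c v = i})))"
    proof (intro sum_mono)
      fix c assume "c \<in> {c \<in> \<Omega>. s < card {v \<in> V. c v = i}}"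
      hence "real s + 1 \<le> real (card {v \<in> V. c v = i})" by simp
      hence "(1 + \<eta>) * \<mu> \<le> real (card {v \<in> V. c v = i})" using s unfolding \<mu>_def by linarith
      thus "exp (\<theta> * ((1 + \<eta>) * \<mu>)) \<le> exp (\<theta> * real (card {v \<in> V. c v = i}))" using \<theta> by simp
    qed
    also have "\<dots> \<le> (\<Sum>c\<in>\<Omega>. exp (\<theta> * real (card {v \<in> V. c v = i})))"
      using fin\<Omega> by (intro sum_mono2) auto
    also have "\<dots> = (real k * (1 + (exp \<theta> - 1) / real k)) ^ card V"
      unfolding \<Omega>_def mgf[OF i] using k by (intro arg_cong[of _ _ "\<lambda>x. x ^ card V"]) (simp add: field_simps)
    also have "\<dots> \<le> (real k * exp ((exp \<theta> - 1) / real k)) ^ card V"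
      using \<theta> k by (intro power_mono mult_left_mono exp_ge_add_one_self) auto
    also have "\<dots> = real k ^ card V * exp (\<mu> * (exp \<theta> - 1))"
      by (simp add: power_mult_distrib \<mu>_def flip: exp_of_nat_mult)
    also have "\<dots> \<le> real k ^ card V * exp (\<mu> * (\<theta> + \<theta>\<^sup>2))"
      using exp_bound[of \<theta>] \<theta> \<mu>0 by (intro mult_left_mono iffD2[OF exp_le_cancel_iff]) auto
    finally have "real (card {c \<in> \<Omega>. s < card {v \<in> V. c v = i}}) \<le>
        real k ^ card V * exp (\<mu> * (\<theta> + \<theta>\<^sup>2)) / exp (\<theta> * ((1 + \<eta>) * \<mu>))" by (simp add: field_simps)
    also have "\<dots> = real k ^ card V * exp (\<mu> * (\<theta> + \<theta>\<^sup>2) - \<theta> * ((1 + \<eta>) * \<mu>))" by (simp add: exp_diff)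
    also have "\<mu> * (\<theta> + \<theta>\<^sup>2) - \<theta> * ((1 + \<eta>) * \<mu>) = - (\<eta>\<^sup>2 * \<mu> / 4)"
      by (simp add: \<theta>_def power2_eq_square algebra_simps)
    finally show ?thesis .
  qed
  have "\<Omega> - ?Bal \<subseteq> (\<Union>i<k. {c \<in> \<Omega>. s < card {v \<in> V. c v = i}})"
    by (auto simp: \<Omega>_def not_le)
  hence "card (\<Omega> - ?Bal) \<le> card (\<Union>i<k. {c \<in> \<Omega>. s < card {v \<in> V. c v = i}})"
    using fin\<Omega> by (intro card_mono) auto
  also have "\<dots> \<le> (\<Sum>i<k. card {c \<in> \<Omega>. s < card {v \<in> V. c v = i}})" by (intro card_UN_le) auto
  finally have "real (card (\<Omega> - ?Bal)) \<le> real (\<Sum>i<k. card {c \<in> \<Omega>. s < card {v \<in> V. c v = i}})"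
    by (rule of_nat_mono)
  also have "\<dots> = (\<Sum>i<k. real (card {c \<in> \<Omega>. s < card {v \<in> V. c v = i}}))" by (rule of_nat_sum)
  also have "\<dots> \<le> (\<Sum>i<k. real k ^ card V * exp (- (\<eta>\<^sup>2 * \<mu> / 4)))" using bad by (intro sum_mono) auto
  also have "\<dots> = real k ^ card V * (real k * exp (- (\<eta>\<^sup>2 * \<mu> / 4)))" by simp
  also have "\<dots> \<le> real k ^ card V * (1 / 2)" using small unfolding \<mu>_def by (intro mult_left_mono) auto
  finally have "real (card (\<Omega> - ?Bal)) \<le> real k ^ card V / 2" by simp
  moreover have "card \<Omega> = card ?Bal + card (\<Omega> - ?Bal)"
  proof -
    have "\<Omega> \<inter> ?Bal = ?Bal" by (auto simp: \<Omega>_def)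
    thus ?thesis using card_Int_Diff[OF fin\<Omega>, of ?Bal] by simp
  qed
  ultimately show ?thesis using card\<Omega> by simp
qed

section \<open>Exponential moments of the square of a binomial variable\<close>

lemma real_choose_two: "real (x choose 2) = real x * (real x - 1) / 2"
  by (cases x) (auto simp: choose_two real_of_nat_div field_simps)

lemma sum_exp_half_le: "(\<Sum>x\<in>A. exp (- (real x / 2))) \<le> 3" if "A \<subseteq> {..m}" for m
proof -
  define q :: real where "q = exp (- (1 / 2))"
  have "exp (1 / 2 :: real) \<ge> 3 / 2" using exp_ge_add_one_self[of "1/2 :: real"] by simp
  hence q: "0 < q" "q \<le> 2 / 3" unfolding q_def by (auto simp: exp_minus field_simps)
  have "(\<Sum>x\<in>A. exp (- (real x / 2))) \<le> (\<Sum>x\<le>m. exp (- (real x / 2)))"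
    using that by (intro sum_mono2) auto
  also have "\<dots> = (\<Sum>x\<le>m. q ^ x)" by (simp add: q_def flip: exp_of_nat_mult)
  also have "\<dots> = (1 - q ^ Suc m) / (1 - q)"
    using q by (subst sum_gp0) auto
  also have "\<dots> \<le> 1 / (1 - q)" using q by (intro divide_right_mono) auto
  also have "\<dots> \<le> 3" using q by (simp add: field_simps)
  finally show ?thesis .
qed

text \<open>Below \<open>2 / r\<close> the factor \<open>1 / x\<close> wins, and beyond that point the left-hand side increases up to
  its value at \<open>x = s\<close>.\<close>

lemma tail_base_le:
  assumes r: "0 < r" and x: "0 < x" "x \<le> s" and \<pi>: "0 < \<pi>"
    and low: "exp 3 * (s * \<pi>) \<le> x" and high: "exp (r * s / 2) * exp 1 * \<pi> \<le> exp (-1)"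
  shows "exp 1 * (s * \<pi>) / x * exp (r * x / 2) \<le> exp (- 1 :: real)"
proof (cases "r * x / 2 \<le> 1")
  case True
  have "exp 1 * (s * \<pi>) / x * exp (r * x / 2) \<le> exp (- 2) * exp 1"
  proof (intro mult_mono)
    have "exp 1 * (s * \<pi>) = exp (- 2) * (exp 3 * (s * \<pi>))" by (simp flip: exp_add mult.assoc)
    also have "\<dots> \<le> exp (- 2) * x" using low by simp
    finally show "exp 1 * (s * \<pi>) / x \<le> exp (- 2)" using x by (simp add: field_simps)
  qed (use True in auto)
  thus ?thesis by (simp flip: exp_add)
next
  case False
  define y where "y = r * x / 2"
  define z where "z = r * s / 2"
  have yz: "1 < y" "y \<le> z" using False x r by (auto simp: y_def z_def)
  \<comment> \<open>Leads to the monotonicity of \<open>exp y / y\<close> for \<open>y\<close> at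
    least 1.\<close>
  have "0 \<le> (y - 1) * (z - y)" using yz by auto
  hence "z \<le> y * (1 + (z - y))" by (simp add: algebra_simps)
  also have "\<dots> \<le> y * exp (z - y)" using yz by (intro mult_left_mono exp_ge_add_one_self) auto
  finally have "exp y * z \<le> exp z * y" using yz by (simp add: exp_diff field_simps)
  hence "exp y * s \<le> exp z * x" using r unfolding y_def z_def by (simp add: field_simps)
  hence "exp 1 * \<pi> * (exp y * s) \<le> exp 1 * \<pi> * (exp z * x)" using \<pi> by (intro mult_left_mono) auto
  hence "exp 1 * (s * \<pi>) / x * exp y \<le> exp z * exp 1 * \<pi>" using x by (simp add: field_simps)
  thus ?thesis using high by (simp add: y_def z_def)
qed

text \<open>In the form of an \<open>x\<close>-th power, the tails become geometric as soon as the
  base is at most \<open>exp (- 1)\<close>, which \<open>tail_base_le\<close> ensures.\<close>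

lemma binom_wt_exp_le:
  assumes r: "0 < r" and x: "0 < x" "x \<le> s" and \<pi>: "0 < \<pi>" "\<pi> \<le> 1"
  shows "binom_wt \<pi> s x * exp (r * real (x choose 2))
    \<le> (exp 1 * (real s * \<pi>) / real x * exp (r * real x / 2)) ^ x"
proof -
  have "binom_wt \<pi> s x \<le> real (s choose x) * \<pi> ^ x" using \<pi> by (intro binom_wt_le) auto
  also have "\<dots> \<le> (exp 1 * real s / real x) ^ x * \<pi> ^ x"
    using \<pi> by (intro mult_right_mono binomial_le_exp_power x) auto
  also have "\<dots> = (exp 1 * (real s * \<pi>) / real x) ^ x" by (simp add: field_simps)
  finally have 1: "binom_wt \<pi> s x \<le> (exp 1 * (real s * \<pi>) / real x) ^ x" .
  have "r * real (x choose 2) \<le> real x * (r * real x / 2)"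
    using r x by (simp add: real_choose_two field_simps)
  hence 2: "exp (r * real (x choose 2)) \<le> exp (r * real x / 2) ^ x"
    by (simp flip: exp_of_nat_mult)
  show ?thesis unfolding power_mult_distrib
    using 1 2 \<pi> by (intro mult_mono) auto
qed

text \<open>The bound will be raised to the power \<open>k * k\<close>, so it has to be 1 plus a
  multiple of \<open>r * \<Lambda>\<^sup>2\<close>; a mere constant would be useless. Typical
  \<open>x\<close> are handled by \<open>exp y \<le> 1 + y * exp y\<close> and the exact mean of
  \<open>x choose 2\<close>, large \<open>x\<close> by a geometric series.\<close>

lemma binomial_exp_square_small:
  assumes r: "0 < r" "r \<le> exp (- 6)" and \<pi>: "0 < \<pi>" "\<pi> \<le> 1"
    and high: "exp (r * real s / 2) * exp 1 * \<pi> \<le> exp (-1)"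
    and small: "r * (real s * \<pi>)\<^sup>2 \<le> exp (- 6)"
  shows "(\<Sum>x\<le>s. binom_wt \<pi> s x * exp (r * real (x choose 2))) \<le> 1 + 125 * (r * (real s * \<pi>)\<^sup>2)"
proof -
  define \<Lambda> where "\<Lambda> = real s * \<pi>"
  have \<Lambda>0: "0 \<le> \<Lambda>" using \<pi> by (simp add: \<Lambda>_def)
  \<comment> \<open>The factor \<open>exp 3\<close> is what \<open>tail_base_le\<close> demands, and
    its square cancels the \<open>exp (- 6)\<close> of the hypotheses, so
    \<open>r * x0\<^sup>2\<close> is at most 1. The maximum with 1 forces \<open>x\<close> to be at
    least 2 beyond \<open>x0\<close>.\<close>
  define x0 where "x0 = exp 3 * max 1 \<Lambda>"
  have x0: "exp 3 * \<Lambda> \<le> x0" "1 \<le> x0"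
    unfolding x0_def using \<Lambda>0 by (auto simp: mult_ge1_I)
  have rx0: "r * x0\<^sup>2 \<le> 1"
  proof -
    have "r * x0\<^sup>2 = exp 6 * (r * (max 1 \<Lambda>)\<^sup>2)"
      by (simp add: x0_def power_mult_distrib flip: exp_of_nat_mult)
    also have "r * (max 1 \<Lambda>)\<^sup>2 \<le> exp (- 6)" using small r by (auto simp: max_def \<Lambda>_def)
    finally show ?thesis by (simp flip: exp_add)
  qed
  have r_half: "r \<le> 1 / 2"
  proof -
    have "exp (6::real) \<ge> 2" using exp_ge_add_one_self[of "6::real"] by linarith
    hence "exp (- 6 :: real) \<le> 1 / 2" by (simp add: exp_minus field_simps)
    thus ?thesis using r by simp
  qed
  define w where "w = binom_wt \<pi> s"
  define f where "f = (\<lambda>x::nat. exp (r * real (x choose 2)))"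
  have w0: "0 \<le> w x" for x using \<pi> by (simp add: w_def binom_wt_nonneg)
  define h where "h = (\<lambda>x. w x * (r * real (x choose 2)) * f x)"
  have fle: "f x \<le> 1 + r * real (x choose 2) * f x" for x
  proof -
    define y where "y = r * real (x choose 2)"
    have "(1 - y) * exp y \<le> exp (- y) * exp y"
      using exp_ge_add_one_self[of "- y"] by (intro mult_right_mono) auto
    hence "exp y \<le> 1 + y * exp y" by (simp add: algebra_simps flip: exp_add)
    thus ?thesis by (simp add: f_def y_def)
  qed
  have main: "h x \<le> 2 * r * (w x * real (x choose 2))" if "real x \<le> x0" for x
  proof -
    have "real x * real x \<le> x0 * x0" using that by (intro mult_mono) auto
    hence "r * (real x * real x) \<le> r * (x0 * x0)" using r by (intro mult_left_mono) auto
    also have "\<dots> \<le> 1" using rx0 by (simp add: power2_eq_square)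
    finally have "r * (real x * real x) \<le> 1" .
    moreover have "r * real (x choose 2) \<le> r * (real x * real x) / 2"
      using r by (simp add: real_choose_two field_simps)
    ultimately have "r * real (x choose 2) \<le> 1 / 2" by linarith
    hence "f x \<le> exp (1 / 2)" by (simp add: f_def)
    also have "\<dots> \<le> 2" using exp_bound_half[of "1/2 :: real"] by simp
    finally have "f x \<le> 2" .
    hence "w x * (r * real (x choose 2)) * f x \<le> w x * (r * real (x choose 2)) * 2"
      using w0[of x] r by (intro mult_left_mono) auto
    thus ?thesis by (simp add: h_def mult_ac)
  qed
  have tail: "h x \<le> r * \<Lambda>\<^sup>2 * exp 4 / 2 * exp (- (real x / 2))" if x: "x0 < real x" "x \<le> s" for x
  proof -
    have x2: "2 \<le> x" using x x0 by linarith
    define u where "u = exp 1 * \<Lambda> / real x * exp (r * real x / 2)"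
    have u0: "0 \<le> u" using \<Lambda>0 by (simp add: u_def)
    have u: "u \<le> exp (- 1)"
      unfolding u_def \<Lambda>_def using r x x0 x2 \<pi> high
      by (intro tail_base_le) (auto simp: \<Lambda>_def)
    have "w x * f x \<le> u ^ x"
      unfolding w_def f_def u_def \<Lambda>_def using r x x2 \<pi> by (intro binom_wt_exp_le) auto
    \<comment> \<open>Two factors \<open>u\<close> are not replaced by \<open>exp (- 1)\<close>:
      together with the square of \<open>x\<close> they supply the factor
      \<open>\<Lambda>\<^sup>2\<close>, needed even when \<open>\<Lambda>\<close> is small.\<close>
    also have "u ^ x = u\<^sup>2 * u ^ (x - 2)" using x2 by (metis le_add_diff_inverse power_add)
    also have "\<dots> \<le> u\<^sup>2 * exp (- 1) ^ (x - 2)" using u u0 by (intro mult_left_mono power_mono) auto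
    also have "exp (- 1) ^ (x - 2) = exp (2 - real x)"
      using x2 by (simp add: of_nat_diff flip: exp_of_nat_mult)
    finally have wf: "w x * f x \<le> u\<^sup>2 * exp (2 - real x)" .
    have "h x = (r * real (x choose 2)) * (w x * f x)" by (simp add: h_def)
    also have "\<dots> \<le> (r * (real x)\<^sup>2 / 2) * (u\<^sup>2 * exp (2 - real x))"
    proof (rule mult_mono[OF _ wf])
      show "r * real (x choose 2) \<le> r * (real x)\<^sup>2 / 2"
        using r by (simp add: real_choose_two field_simps power2_eq_square)
    qed (use r w0[of x] in \<open>auto simp: f_def\<close>)
    also have "\<dots> = r / 2 * (real x * u)\<^sup>2 * exp (2 - real x)" by (simp add: power_mult_distrib)
    also have "real x * u = exp 1 * \<Lambda> * exp (r * real x / 2)" using x2 by (simp add: u_def)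
    also have "r / 2 * (exp 1 * \<Lambda> * exp (r * real x / 2))\<^sup>2 * exp (2 - real x)
        = r * \<Lambda>\<^sup>2 / 2 * (exp (2 * 1) * exp (r * real x) * exp (2 - real x))"
      by (simp add: power_mult_distrib flip: exp_double)
    also have "exp (2 * 1) * exp (r * real x) * exp (2 - real x) = exp 4 * exp (r * real x - real x)"
      by (simp flip: exp_add)
    also have "r * \<Lambda>\<^sup>2 / 2 * (exp 4 * exp (r * real x - real x))
        \<le> r * \<Lambda>\<^sup>2 / 2 * (exp 4 * exp (- (real x / 2)))"
    proof -
      have "r * real x \<le> 1 / 2 * real x" using r_half by (intro mult_right_mono) auto
      thus ?thesis using r by (intro mult_left_mono) auto
    qed
    finally show ?thesis by (simp add: mult_ac)
  qed
  have "(\<Sum>x\<le>s. w x * f x) \<le> (\<Sum>x\<le>s. w x + h x)"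
  proof (intro sum_mono)
    fix x
    have "w x * f x \<le> w x * (1 + r * real (x choose 2) * f x)" using fle w0 by (intro mult_left_mono)
    thus "w x * f x \<le> w x + h x" by (simp add: h_def algebra_simps)
  qed
  also have "\<dots> = 1 + (\<Sum>x\<le>s. h x)" by (simp add: sum.distrib w_def sum_binom_wt)
  also have "(\<Sum>x\<le>s. h x) \<le> (\<Sum>x\<le>s. 2 * r * (w x * real (x choose 2)) +
      (if x0 < real x then r * \<Lambda>\<^sup>2 * exp 4 / 2 * exp (- (real x / 2)) else 0))"
  proof (intro sum_mono)
    fix x assume "x \<in> {..s}"
    thus "h x \<le> 2 * r * (w x * real (x choose 2)) +
      (if x0 < real x then r * \<Lambda>\<^sup>2 * exp 4 / 2 * exp (- (real x / 2)) else 0)"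
      using main[of x] tail[of x] r w0[of x] by (cases "x0 < real x") (auto intro: add_increasing)
  qed
  also have "\<dots> = 2 * r * (real (s choose 2) * \<pi>\<^sup>2) +
      (\<Sum>x\<in>{x. x \<le> s \<and> x0 < real x}. r * \<Lambda>\<^sup>2 * exp 4 / 2 * exp (- (real x / 2)))"
    using sum.inter_filter[of "{..s}" "\<lambda>x. r * \<Lambda>\<^sup>2 * exp 4 / 2 * exp (- (real x / 2))" "\<lambda>x. x0 < real x"]
    unfolding sum.distrib sum_distrib_left[of "2 * r", symmetric] w_def sum_binom_wt_choose_2 by simp
  also have "\<dots> \<le> r * \<Lambda>\<^sup>2 + r * \<Lambda>\<^sup>2 * exp 4 / 2 * 3"
  proof (intro add_mono)
    have "real (s choose 2) \<le> (real s)\<^sup>2 / 2" by (simp add: real_choose_two field_simps power2_eq_square)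
    hence "real (s choose 2) * \<pi>\<^sup>2 \<le> (real s)\<^sup>2 / 2 * \<pi>\<^sup>2" by (intro mult_right_mono) auto
    hence "2 * r * (real (s choose 2) * \<pi>\<^sup>2) \<le> 2 * r * ((real s)\<^sup>2 / 2 * \<pi>\<^sup>2)"
      using r by (intro mult_left_mono) auto
    thus "2 * r * (real (s choose 2) * \<pi>\<^sup>2) \<le> r * \<Lambda>\<^sup>2" by (simp add: \<Lambda>_def power_mult_distrib)
    show "(\<Sum>x\<in>{x. x \<le> s \<and> x0 < real x}. r * \<Lambda>\<^sup>2 * exp 4 / 2 * exp (- (real x / 2)))
        \<le> r * \<Lambda>\<^sup>2 * exp 4 / 2 * 3"
      unfolding sum_distrib_left[symmetric] using r
      by (intro mult_left_mono sum_exp_half_le[of _ s]) auto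
  qed
  also have "\<dots> = r * \<Lambda>\<^sup>2 * (1 + 3 / 2 * exp 4)" by (simp add: algebra_simps)
  also have "\<dots> \<le> r * \<Lambda>\<^sup>2 * 125"
  proof (intro mult_left_mono)
    have "exp (4::real) = exp 1 ^ 4" by (simp flip: exp_of_nat_mult)
    also have "\<dots> \<le> 3 ^ 4" using exp_le by (intro power_mono) auto
    finally show "1 + 3 / 2 * exp 4 \<le> (125::real)" by simp
  qed (use r in auto)
  finally show ?thesis by (simp add: w_def f_def \<Lambda>_def mult_ac)
qed

text \<open>Meant for large \<open>\<Lambda>\<close>. Up to \<open>a\<close> the square of
  \<open>x\<close> is at most \<open>a * x\<close>, which leaves an ordinary binomial generating
  function. Beyond \<open>a\<close> the terms are at most \<open>exp (- x)\<close>; half of this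
  exponent pays for \<open>exp (- \<Lambda>)\<close>, the other half for summability.\<close>

lemma binomial_exp_square_large:
  assumes r: "0 < r" and \<pi>: "0 < \<pi>" "\<pi> \<le> 1"
    and high: "exp (r * real s / 2) * exp 1 * \<pi> \<le> exp (-1)"
    and small: "exp 3 * (r * (real s * \<pi>)) \<le> 2"
  shows "(\<Sum>x\<le>s. binom_wt \<pi> s x * exp (r * real (x choose 2)))
    \<le> exp (exp 3 * (r * (real s * \<pi>)\<^sup>2)) + 3 * exp (- (real s * \<pi>))"
proof -
  define \<Lambda> where "\<Lambda> = real s * \<pi>"
  have \<Lambda>0: "0 \<le> \<Lambda>" using \<pi> by (simp add: \<Lambda>_def)
  define a where "a = exp 3 * \<Lambda>"
  have a0: "0 \<le> a" using \<Lambda>0 by (simp add: a_def)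
  define \<theta> where "\<theta> = r * a / 2"
  have \<theta>: "0 \<le> \<theta>" "\<theta> \<le> 1" using r a0 small
    by (simp_all add: \<theta>_def) (simp add: a_def \<Lambda>_def mult_ac)
  define w where "w = binom_wt \<pi> s"
  have w0: "0 \<le> w x" for x using \<pi> by (simp add: w_def binom_wt_nonneg)
  have a2: "2 * \<Lambda> \<le> a"
    unfolding a_def using \<Lambda>0 exp_ge_add_one_self[of "3::real"] by (intro mult_right_mono) auto
  have main: "w x * exp (r * real (x choose 2)) \<le> w x * exp \<theta> ^ x" if "real x \<le> a" for x
  proof -
    have "real x * real x \<le> a * real x" using that by (intro mult_right_mono) auto
    hence "real (x choose 2) \<le> a * real x / 2" by (simp add: real_choose_two field_simps)
    hence "r * real (x choose 2) \<le> r * (a * real x / 2)" using r by (intro mult_left_mono) auto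
    hence "exp (r * real (x choose 2)) \<le> exp \<theta> ^ x" by (simp add: \<theta>_def mult_ac flip: exp_of_nat_mult)
    thus ?thesis using w0 by (intro mult_left_mono)
  qed
  have tail: "w x * exp (r * real (x choose 2)) \<le> exp (- \<Lambda>) * exp (- (real x / 2))"
    if x: "a < real x" "x \<le> s" for x
  proof -
    have x0: "0 < x" using x a0 by (metis gr0I not_less of_nat_0)
    have "w x * exp (r * real (x choose 2)) \<le> (exp 1 * \<Lambda> / real x * exp (r * real x / 2)) ^ x"
      unfolding w_def \<Lambda>_def using r x x0 \<pi> by (intro binom_wt_exp_le) auto
    also have "\<dots> \<le> exp (- 1) ^ x"
    proof (intro power_mono)
      show "exp 1 * \<Lambda> / real x * exp (r * real x / 2) \<le> exp (- 1)"
        unfolding \<Lambda>_def using r x x0 \<pi> high by (intro tail_base_le) (auto simp: a_def \<Lambda>_def)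
    qed (use \<Lambda>0 in auto)
    also have "\<dots> = exp (- (real x / 2)) * exp (- (real x / 2))"
      by (simp flip: exp_of_nat_mult exp_add)
    also have "\<dots> \<le> exp (- \<Lambda>) * exp (- (real x / 2))"
      using x a2 by (intro mult_right_mono) auto
    finally show ?thesis .
  qed
  have "(\<Sum>x\<le>s. w x * exp (r * real (x choose 2))) \<le>
     (\<Sum>x\<le>s. w x * exp \<theta> ^ x + (if a < real x then exp (- \<Lambda>) * exp (- (real x / 2)) else 0))"
  proof (intro sum_mono)
    fix x assume "x \<in> {..s}"
    thus "w x * exp (r * real (x choose 2))
        \<le> w x * exp \<theta> ^ x + (if a < real x then exp (- \<Lambda>) * exp (- (real x / 2)) else 0)"
      using main[of x] tail[of x] w0[of x] by (cases "a < real x") (auto intro: add_increasing)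
  qed
  also have "\<dots> = (1 - \<pi> + \<pi> * exp \<theta>) ^ s +
      (\<Sum>x\<in>{x. x \<le> s \<and> a < real x}. exp (- \<Lambda>) * exp (- (real x / 2)))"
    unfolding sum.distrib w_def sum_binom_wt_power by (simp add: sum.If_cases Int_def)
  also have "\<dots> \<le> exp (exp 3 * (r * \<Lambda>\<^sup>2)) + exp (- \<Lambda>) * 3"
  proof (intro add_mono)
    have "1 - \<pi> + \<pi> * exp \<theta> = 1 + \<pi> * (exp \<theta> - 1)" by (simp add: algebra_simps)
    also have "\<dots> \<le> 1 + \<pi> * (2 * \<theta>)"
    proof -
      have "\<theta>\<^sup>2 \<le> \<theta>" using \<theta> by (simp add: power2_eq_square mult_left_le)
      hence "exp \<theta> - 1 \<le> 2 * \<theta>" using exp_bound[of \<theta>] \<theta> by simp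
      thus ?thesis using \<pi> by simp
    qed
    also have "\<dots> \<le> exp (\<pi> * (2 * \<theta>))" by (rule exp_ge_add_one_self)
    finally have "(1 - \<pi> + \<pi> * exp \<theta>) ^ s \<le> exp (\<pi> * (2 * \<theta>)) ^ s"
      using \<pi> by (intro power_mono) auto
    also have "\<dots> = exp (exp 3 * (r * \<Lambda>\<^sup>2))"
      by (simp add: \<theta>_def a_def \<Lambda>_def power2_eq_square mult_ac flip: exp_of_nat_mult)
    finally show "(1 - \<pi> + \<pi> * exp \<theta>) ^ s \<le> exp (exp 3 * (r * \<Lambda>\<^sup>2))" .
    show "(\<Sum>x\<in>{x. x \<le> s \<and> a < real x}. exp (- \<Lambda>) * exp (- (real x / 2))) \<le> exp (- \<Lambda>) * 3"
      unfolding sum_distrib_left[symmetric] by (intro mult_left_mono sum_exp_half_le[of _ s]) auto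
  qed
  finally show ?thesis by (simp add: w_def \<Lambda>_def mult_ac)
qed

text \<open>With the mean overlap \<open>\<Lambda> = s / k\<close> one has
  \<open>k * k * (r * \<Lambda>\<^sup>2) = r * s\<^sup>2\<close>, which is at most
  \<open>4 * L\<^sup>2 / p\<close>. For small \<open>r * \<Lambda>\<^sup>2\<close> this is the
  exponent up to a constant; otherwise \<open>\<Lambda>\<close> is at least \<open>sqrt d\<close>,
  and \<open>k * k\<close> terms \<open>exp (- \<Lambda>)\<close> are negligible.\<close>

lemma pair_average_bound:
  fixes d p x r L :: real and k s :: nat
  assumes p: "0 < p" "p < 1" and r_def: "r = - ln (1 - p)" and r_small: "r \<le> exp (- 6)"
    and s: "r * real s \<le> 2 * (1 - x) * L"
    and x: "0 < x" "x < 1"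
    and d: "1 < d" and L_def: "L = ln d"
    and k: "d / (2 * L) \<le> real k" "real k \<le> d / L"
    and c1: "2 * exp 1 * L * exp (- x * L) \<le> exp (- 1)"
    and c2: "exp 3 * (4 * L\<^sup>2 / d) \<le> 2"
    and c3: "500 * L\<^sup>2 \<le> sqrt d"
    and c4: "exp 3 * (4 * L\<^sup>2) + 6 * d * exp (- sqrt d) \<le> sqrt d"
    and c5: "sqrt d * (4 * L\<^sup>2 / d) \<le> exp (- 6)"
  shows "(\<Sum>x\<le>s. binom_wt (1 / real k) s x * (1 / (1 - p)) ^ (x choose 2)) ^ (k * k) \<le> exp (sqrt d / p)"
proof -
  have L: "0 < L" using d by (simp add: L_def)
  have expL: "exp L = d" using d by (simp add: L_def)
  have k0: "0 < real k" using k(1) d L by (smt (verit) divide_pos_pos)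
  have "1 \<le> real k" using k0 by simp
  have pr: "p \<le> r" using p ln_add_one_self_le_self2[of "- p"] by (simp add: r_def)
  have r: "0 < r" using p pr by simp
  define \<pi> where "\<pi> = 1 / real k"
  have \<pi>: "0 < \<pi>" "\<pi> \<le> 1" using k0 by (auto simp: \<pi>_def)
  define \<Lambda> where "\<Lambda> = real s * \<pi>"
  have \<pi>le: "\<pi> \<le> 2 * L / d" using k(1) k0 d L by (simp add: \<pi>_def field_simps)
  have \<Lambda>0: "0 \<le> \<Lambda>" using \<pi> by (simp add: \<Lambda>_def)
  have "(1 - x) * L \<le> 1 * L" using x L by (intro mult_right_mono) auto
  hence rs: "r * real s \<le> 2 * L" using s by linarith
  have r\<Lambda>: "r * \<Lambda> \<le> 4 * L\<^sup>2 / d"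
  proof -
    have "r * \<Lambda> = (r * real s) * \<pi>" by (simp add: \<Lambda>_def)
    also have "\<dots> \<le> (2 * L) * (2 * L / d)" using L \<pi> by (intro mult_mono[OF rs \<pi>le]) auto
    finally show ?thesis by (simp add: power2_eq_square)
  qed
  have rs2: "r * (real s)\<^sup>2 \<le> 4 * L\<^sup>2 / p"
  proof -
    have "(r * real s)\<^sup>2 \<le> (2 * L)\<^sup>2" using rs r by (intro power_mono) auto
    hence "r * (real s)\<^sup>2 \<le> 4 * L\<^sup>2 / r" using r by (simp add: field_simps power2_eq_square)
    also have "\<dots> \<le> 4 * L\<^sup>2 / p" using pr p by (intro divide_left_mono) auto
    finally show ?thesis .
  qed
  \<comment> \<open>This decides the class size \<open>2 * L / r\<close>: sharing an entire class
    gains \<open>exp (r * s / 2)\<close> per vertex, at most \<open>d powr (1 - x)\<close>, against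
    a chance \<open>\<pi>\<close> of at most \<open>2 * L / d\<close>. The margin \<open>x\<close>
    lets the chance win.\<close>
  have high: "exp (r * real s / 2) * exp 1 * \<pi> \<le> exp (- 1)"
  proof -
    have "r * real s / 2 \<le> (1 - x) * L" using s by linarith
    hence "exp (r * real s / 2) \<le> exp ((1 - x) * L)" by simp
    hence "exp (r * real s / 2) * exp 1 * \<pi> \<le> exp ((1 - x) * L) * exp 1 * (2 * L / d)"
      using \<pi>le \<pi> by (intro mult_mono) auto
    also have "exp ((1 - x) * L) = d * exp (- x * L)"
    proof -
      have "exp ((1 - x) * L) = exp (L + - x * L)" by (simp add: algebra_simps)
      thus ?thesis by (simp only: exp_add expL)
    qed
    also have "d * exp (- x * L) * exp 1 * (2 * L / d) = 2 * exp 1 * L * exp (- x * L)" using d by simp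
    also have "\<dots> \<le> exp (- 1)" by (rule c1)
    finally show ?thesis .
  qed
  define \<Phi> where "\<Phi> = (\<Sum>x\<le>s. binom_wt \<pi> s x * exp (r * real (x choose 2)))"
  have er: "exp r = 1 / (1 - p)" using p by (simp add: r_def exp_minus field_simps)
  have \<Phi>eq: "(\<Sum>x\<le>s. binom_wt (1 / real k) s x * (1 / (1 - p)) ^ (x choose 2)) = \<Phi>"
    unfolding \<Phi>_def \<pi>_def er[symmetric] by (simp add: mult.commute flip: exp_of_nat_mult)
  have \<Phi>0: "0 \<le> \<Phi>" unfolding \<Phi>_def using \<pi> by (intro sum_nonneg mult_nonneg_nonneg binom_wt_nonneg) auto
  have k\<Lambda>: "real (k * k) * (r * \<Lambda>\<^sup>2) = r * (real s)\<^sup>2"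
    using k0 by (simp add: \<Lambda>_def \<pi>_def field_simps power2_eq_square)
  have "\<exists>E. \<Phi> \<le> exp E \<and> real (k * k) * E \<le> sqrt d / p"
  proof (cases "r * \<Lambda>\<^sup>2 \<le> exp (- 6)")
    case True
    have "\<Phi> \<le> 1 + 125 * (r * \<Lambda>\<^sup>2)"
      unfolding \<Phi>_def \<Lambda>_def using r r_small \<pi> high True
      by (intro binomial_exp_square_small) (auto simp: \<Lambda>_def)
    also have "\<dots> \<le> exp (125 * (r * \<Lambda>\<^sup>2))" by (rule exp_ge_add_one_self)
    finally have 1: "\<Phi> \<le> exp (125 * (r * \<Lambda>\<^sup>2))" .
    have "real (k * k) * (125 * (r * \<Lambda>\<^sup>2)) = 125 * (r * (real s)\<^sup>2)" using k\<Lambda> by simp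
    also have "\<dots> \<le> 125 * (4 * L\<^sup>2 / p)" using rs2 by simp
    also have "\<dots> = 500 * L\<^sup>2 / p" by simp
    also have "\<dots> \<le> sqrt d / p" using c3 p by (intro divide_right_mono) auto
    finally show ?thesis using 1 by blast
  next
    case False
    hence \<Lambda>pos: "0 < \<Lambda>" using \<Lambda>0 by (cases "\<Lambda> = 0") auto
    \<comment> \<open>Since \<open>r * \<Lambda>\<close> is at most
      \<open>4 * L\<^sup>2 / d\<close>, failing the first case forces \<open>\<Lambda>\<close> to be
      at least \<open>sqrt d\<close>; \<open>c5\<close> is there for this.\<close>
    have "sqrt d * (4 * L\<^sup>2 / d) \<le> r * \<Lambda>\<^sup>2" using c5 False by simp
    also have "\<dots> = \<Lambda> * (r * \<Lambda>)" by (simp add: power2_eq_square)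
    also have "\<dots> \<le> \<Lambda> * (4 * L\<^sup>2 / d)" using r\<Lambda> \<Lambda>0 by (intro mult_left_mono)
    finally have \<Lambda>d: "sqrt d \<le> \<Lambda>" using L d by (rule_tac mult_right_le_imp_le[of _ "4 * L\<^sup>2 / d"]) auto
    have "\<Phi> \<le> exp (exp 3 * (r * \<Lambda>\<^sup>2)) + 3 * exp (- \<Lambda>)"
      unfolding \<Phi>_def \<Lambda>_def
    proof (intro binomial_exp_square_large)
      have "exp 3 * (r * \<Lambda>) \<le> exp 3 * (4 * L\<^sup>2 / d)" using r\<Lambda> by (rule mult_left_mono) simp
      thus "exp 3 * (r * (real s * \<pi>)) \<le> 2" using c2 by (simp add: \<Lambda>_def)
    qed (use r \<pi> high in auto)
    also have "\<dots> \<le> exp (exp 3 * (r * \<Lambda>\<^sup>2)) + exp (exp 3 * (r * \<Lambda>\<^sup>2)) * (3 * exp (- \<Lambda>))"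
    proof -
      have "1 * (3 * exp (- \<Lambda>)) \<le> exp (exp 3 * (r * \<Lambda>\<^sup>2)) * (3 * exp (- \<Lambda>))"
        using r by (intro mult_right_mono) auto
      thus ?thesis by simp
    qed
    also have "\<dots> = exp (exp 3 * (r * \<Lambda>\<^sup>2)) * (1 + 3 * exp (- \<Lambda>))" by (simp add: algebra_simps)
    also have "\<dots> \<le> exp (exp 3 * (r * \<Lambda>\<^sup>2)) * exp (3 * exp (- \<Lambda>))"
      by (intro mult_left_mono exp_ge_add_one_self) auto
    finally have 1: "\<Phi> \<le> exp (exp 3 * (r * \<Lambda>\<^sup>2) + 3 * exp (- \<Lambda>))" by (simp add: exp_add)
    have "1 \<le> sqrt d" using d by simp
    \<comment> \<open>Only one factor \<open>k\<close> is bounded by \<open>d / L\<close>. The other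
      is \<open>s / \<Lambda>\<close>, hence at most \<open>s\<close>, and brings in the
      \<open>1 / p\<close> of the target exponent.\<close>
    have kk: "real (k * k) \<le> 2 * d / p"
    proof -
      have "\<Lambda> * real k = real s" using k0 by (simp add: \<Lambda>_def \<pi>_def)
      hence "real k = real s / \<Lambda>" using \<Lambda>pos by (simp add: field_simps)
      also have "\<dots> \<le> real s / 1" using order_trans[OF \<open>1 \<le> sqrt d\<close> \<Lambda>d] by (intro divide_left_mono) auto
      also have "\<dots> \<le> 2 * L / r" using rs r by (simp add: field_simps)
      also have "\<dots> \<le> 2 * L / p" using pr p L by (intro divide_left_mono) auto
      finally have "real k * real k \<le> d / L * (2 * L / p)" using k k0 d L by (intro mult_mono) auto
      thus ?thesis using L by (simp add: mult.commute)
    qed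
    have "real (k * k) * exp (- \<Lambda>) \<le> 2 * d / p * exp (- sqrt d)"
      using kk \<Lambda>d d p by (intro mult_mono) auto
    moreover have "exp 3 * (r * (real s)\<^sup>2) \<le> exp 3 * (4 * L\<^sup>2 / p)" using rs2 by (rule mult_left_mono) simp
    moreover have "real (k * k) * (exp 3 * (r * \<Lambda>\<^sup>2) + 3 * exp (- \<Lambda>))
        = exp 3 * (r * (real s)\<^sup>2) + 3 * (real (k * k) * exp (- \<Lambda>))"
      unfolding k\<Lambda>[symmetric] by (simp add: algebra_simps)
    ultimately have "real (k * k) * (exp 3 * (r * \<Lambda>\<^sup>2) + 3 * exp (- \<Lambda>))
        \<le> exp 3 * (4 * L\<^sup>2 / p) + 3 * (2 * d / p * exp (- sqrt d))" by linarith
    also have "\<dots> = (exp 3 * (4 * L\<^sup>2) + 6 * d * exp (- sqrt d)) / p" using p by (simp add: field_simps)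
    also have "\<dots> \<le> sqrt d / p" using c4 p by (intro divide_right_mono) auto
    finally show ?thesis using 1 by blast
  qed
  then obtain E where E: "\<Phi> \<le> exp E" "real (k * k) * E \<le> sqrt d / p" by blast
  have "\<Phi> ^ (k * k) \<le> exp E ^ (k * k)" using E \<Phi>0 by (intro power_mono)
  also have "\<dots> = exp (real (k * k) * E)" by (simp only: exp_of_nat_mult)
  also have "\<dots> \<le> exp (sqrt d / p)" using E by simp
  finally show ?thesis unfolding \<Phi>eq .
qed

lemma prob_colourable_ge:
  fixes d p x r L :: real and k :: nat and V :: "'a set"
  assumes V: "finite V" and dV: "d = real (card V) * p"
    and p: "0 < p" "p < 1" and r_def: "r = - ln (1 - p)" and r_small: "r \<le> exp (- 6)"
    and rp: "r \<le> (1 + x) * p"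
    and x: "0 < x" "x \<le> 1 / 8" and px: "p \<le> x\<^sup>2 / 8"
    and d: "1 < d" and L_def: "L = ln d" and dL: "2 \<le> d * L"
    and k: "(1 + 8 * x) * d / (2 * L) \<le> real k" "real k \<le> d / L"
    and c1: "2 * exp 1 * L * exp (- x * L) \<le> exp (- 1)"
    and c2: "exp 3 * (4 * L\<^sup>2 / d) \<le> 2"
    and c3: "500 * L\<^sup>2 \<le> sqrt d"
    and c4: "exp 3 * (4 * L\<^sup>2) + 6 * d * exp (- sqrt d) \<le> sqrt d"
    and c5: "sqrt d * (4 * L\<^sup>2 / d) \<le> exp (- 6)"
  shows "exp (- (sqrt d / p)) / 2 \<le> expect p (all_edges V) (\<lambda>F. of_bool (colourable k V F))"
proof -
  have L: "0 < L" using d by (simp add: L_def)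
  have pr: "p \<le> r" using p ln_add_one_self_le_self2[of "- p"] by (simp add: r_def)
  have r: "0 < r" using p pr by simp
  define s where "s = nat \<lfloor>2 * (1 - x) * L / r\<rfloor>"
  have q0: "0 \<le> 2 * (1 - x) * L / r" using x L r by auto
  have s_le: "real s \<le> 2 * (1 - x) * L / r" unfolding s_def using q0 by simp
  have s_ge: "2 * (1 - x) * L / r \<le> real s + 1" unfolding s_def using q0 by linarith
  have kpos: "0 < real k" using k(1) d L x by (smt (verit) divide_pos_pos mult_pos_pos)
  have k1: "d / (2 * L) \<le> real k"
  proof -
    have "1 * d / (2 * L) \<le> (1 + 8 * x) * d / (2 * L)" using d L x by (intro divide_right_mono mult_right_mono) auto
    thus ?thesis using k by simp
  qed
  define \<mu> where "\<mu> = real (card V) / real k"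
  have V0: "real (card V) = d / p" using dV p by simp
  have bal1: "(1 + x) * \<mu> \<le> real s + 1"
  proof -
    have "\<mu> = d / (p * real k)" by (simp add: \<mu>_def V0)
    also have "\<dots> \<le> d / (p * ((1 + 8 * x) * d / (2 * L)))"
      using k(1) kpos p d L x by (intro divide_left_mono mult_left_mono mult_pos_pos divide_pos_pos) auto
    also have "\<dots> = 2 * L / ((1 + 8 * x) * p)"
    proof -
      have "d / (p * (c * d / (2 * L))) = 2 * L / (c * p)" if "c \<noteq> 0" for c
        using d p L that by (simp add: field_simps)
      thus ?thesis using x by simp
    qed
    finally have "(1 + x) * \<mu> \<le> (1 + x) * (2 * L / ((1 + 8 * x) * p))" using x by (intro mult_left_mono) auto
    also have "\<dots> \<le> 2 * (1 - x) * L / r"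
    proof -
      \<comment> \<open>The surplus \<open>8 * x\<close> in the number of colours pays for three
        losses: \<open>1 + x\<close> for balance, \<open>1 + x\<close> for \<open>r\<close> against
        \<open>p\<close>, and \<open>1 - x\<close> in the choice of \<open>s\<close>.\<close>
      have "9 * x \<le> 5" using x by simp
      hence "x * (9 * x) \<le> x * 5" using x by (intro mult_left_mono) auto
      hence poly: "(1 + x) * (1 + x) \<le> (1 - x) * (1 + 8 * x)" by (simp add: algebra_simps)
      have "(1 + x) * r \<le> (1 + x) * ((1 + x) * p)" using rp x by (intro mult_left_mono) auto
      also have "\<dots> \<le> (1 - x) * (1 + 8 * x) * p" using poly p by (simp flip: mult.assoc)
      finally have "2 * L * ((1 + x) * r) \<le> 2 * L * ((1 - x) * (1 + 8 * x) * p)" using L by (intro mult_left_mono) auto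
      hence "2 * L * ((1 + x) * r) / ((1 + 8 * x) * p * r) \<le>
          2 * L * ((1 - x) * (1 + 8 * x) * p) / ((1 + 8 * x) * p * r)"
        using r p x by (intro divide_right_mono) auto
      moreover have "2 * L * ((1 + x) * r) / ((1 + 8 * x) * p * r) = (1 + x) * (2 * L / ((1 + 8 * x) * p))"
        using r by simp
      moreover have "2 * L * ((1 - x) * (1 + 8 * x) * p) / ((1 + 8 * x) * p * r) = 2 * (1 - x) * L / r"
        using p x by simp
      ultimately show ?thesis by simp
    qed
    finally show ?thesis using s_ge by linarith
  qed
  have bal2: "real k * exp (- (x\<^sup>2 * \<mu> / 4)) \<le> 1 / 2"
  proof -
    have "L / p = (d / p) / (d / L)" using d L by simp
    also have "\<dots> \<le> \<mu>" unfolding \<mu>_def V0 using k(2) kpos d p L by (intro divide_left_mono) auto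
    finally have "L / p \<le> \<mu>" .
    \<comment> \<open>The bound \<open>x\<^sup>2 / 8\<close> on \<open>p\<close> is chosen so that
      one class is too large with probability at most \<open>exp (- (2 * L))\<close>, the inverse
      square of \<open>d\<close>; this beats the union over at most \<open>d / L\<close>
      colours.\<close>
    have "2 * L = (8 * p) * (L / p) / 4" using p by simp
    also have "\<dots> \<le> x\<^sup>2 * \<mu> / 4"
      using px \<open>L / p \<le> \<mu>\<close> p L by (intro divide_right_mono mult_mono) auto
    finally have "exp (- (x\<^sup>2 * \<mu> / 4)) \<le> exp (- (2 * L))" by simp
    also have "exp (- (2 * L)) = 1 / (exp L * exp L)"
      by (simp add: exp_minus exp_double power2_eq_square inverse_eq_divide)
    also have "exp L = d" using d by (simp add: L_def)
    finally have "real k * exp (- (x\<^sup>2 * \<mu> / 4)) \<le> d / L * (1 / (d * d))"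
      using k(2) kpos d L by (intro mult_mono) auto
    also have "\<dots> = 1 / (d * L)" using d by simp
    also have "\<dots> \<le> 1 / 2" using dL by (intro divide_left_mono) auto
    finally show ?thesis .
  qed
  define Bal where "Bal = {c \<in> PiE V (\<lambda>_. {..<k}). \<forall>i<k. card {v \<in> V. c v = i} \<le> s}"
  have Bal: "real k ^ card V / 2 \<le> real (card Bal)"
    unfolding Bal_def using V kpos x bal1 bal2 unfolding \<mu>_def by (intro balanced_colourings) auto
  define Q where "Q = real k ^ card V * exp (sqrt d / p)"
  have Q: "0 < Q" using kpos by (simp add: Q_def)
  have "real (card Bal) / Q \<le> expect p (all_edges V) (\<lambda>F. of_bool (colourable k V F))"
  proof (intro second_moment_colourable[OF V p Q])
    show "Bal \<subseteq> PiE V (\<lambda>_. {..<k})" by (auto simp: Bal_def)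
    fix c assume c: "c \<in> Bal"
    have "(\<Sum>c'\<in>PiE V (\<lambda>_. {..<k}). (1 / (1 - p)) ^ card (mono_pairs c V \<inter> mono_pairs c' V))
      \<le> real k ^ card V * (\<Sum>x\<le>s. binom_wt (1 / real k) s x * (1 / (1 - p)) ^ (x choose 2)) ^ (k * k)"
      using V kpos p c by (intro colouring_pair_average) (auto simp: Bal_def)
    also have "\<dots> \<le> Q" unfolding Q_def
    proof (intro mult_left_mono pair_average_bound[where x = x])
      show "r * real s \<le> 2 * (1 - x) * L" using s_le r by (simp add: field_simps)
    qed (use p r_def r_small x d L_def k1 k c1 c2 c3 c4 c5 in auto)
    finally show "(\<Sum>c'\<in>PiE V (\<lambda>_. {..<k}). (1 / (1 - p)) ^ card (mono_pairs c V \<inter> mono_pairs c' V)) \<le> Q" .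
  qed
  moreover have "exp (- (sqrt d / p)) / 2 = (real k ^ card V / 2) / Q"
    using kpos by (simp add: Q_def exp_minus field_simps)
  moreover have "(real k ^ card V / 2) / Q \<le> real (card Bal) / Q"
    using Bal Q by (intro divide_right_mono) auto
  ultimately show ?thesis by linarith
qed

section \<open>Removing few vertices\<close>

definition defect :: "nat \<Rightarrow> 'a set \<Rightarrow> 'a set set \<Rightarrow> nat" where
  "defect k V F = (LEAST m. \<exists>U\<subseteq>V. card U = m \<and> colourable k (V - U) F)"

lemma defect_le: "U \<subseteq> V \<Longrightarrow> colourable k (V - U) F \<Longrightarrow> defect k V F \<le> card U"
  unfolding defect_def by (rule Least_le) blast

lemma defect_attained:
  obtains U where "U \<subseteq> V" "card U = defect k V F" "colourable k (V - U) F"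
proof -
  have "\<exists>m. \<exists>U\<subseteq>V. card U = m \<and> colourable k (V - U) F"
    by (rule exI[of _ "card V"], rule exI[of _ V]) (simp add: colourable_empty)
  hence "\<exists>U\<subseteq>V. card U = defect k V F \<and> colourable k (V - U) F"
    unfolding defect_def by (rule LeastI_ex)
  thus ?thesis using that by blast
qed

lemma defect_eq_0: "colourable k V F \<Longrightarrow> defect k V F = 0"
  using defect_le[of "{}" V k F] by simp

text \<open>Removing \<open>v\<close> in addition to an optimal set for \<open>F'\<close> makes all
  edges at \<open>v\<close> irrelevant, and \<open>F\<close> and \<open>F'\<close> agree
  elsewhere.\<close>

lemma defect_vertex_change:
  assumes "finite V" "v \<in> V" "\<And>e. e \<in> B \<Longrightarrow> v \<in> e" "F - B = F' - B"
  shows "defect k V F \<le> defect k V F' + 1"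
proof -
  obtain U where U: "U \<subseteq> V" "card U = defect k V F'" "colourable k (V - U) F'"
    by (rule defect_attained)
  then obtain c where c: "c ` (V - U) \<subseteq> {..<k}" "F' \<inter> mono_pairs c (V - U) = {}"
    unfolding colourable_def by blast
  have "F \<inter> mono_pairs c (V - insert v U) = {}"
  proof (rule equals0I)
    fix e assume e: "e \<in> F \<inter> mono_pairs c (V - insert v U)"
    hence "v \<notin> e" by (auto simp: mono_pairs_def all_edges_def)
    hence "e \<in> F'" using assms(3,4) e by blast
    moreover have "e \<in> mono_pairs c (V - U)" using e by (auto simp: mono_pairs_def all_edges_def)
    ultimately show False using c by blast
  qed
  moreover have "c ` (V - insert v U) \<subseteq> {..<k}" using c by blast
  ultimately have "colourable k (V - insert v U) F" unfolding colourable_def by blast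
  hence "defect k V F \<le> card (insert v U)" using U assms(2) by (intro defect_le) auto
  also have "\<dots> \<le> card U + 1" using finite_subset[OF U(1) assms(1)] by (simp add: card_insert_if)
  finally show ?thesis using U by simp
qed

text \<open>On colourable graphs the defect is 0 and \<open>exp (- \<theta> * Y)\<close> is 1, so
  the product of the two exponential moments bounds the product of the two probabilities. No
  knowledge of the mean or median of the defect is required.\<close>

lemma prob_defect_large:
  fixes p b \<theta> :: real and n k :: nat
  assumes p: "0 \<le> p" "p \<le> 1" and \<theta>: "0 \<le> \<theta>" "\<theta> \<le> 1"
  defines "I \<equiv> all_edges {1..n}"
  shows "expect p I (\<lambda>F. of_bool (b \<le> real (defect k {1..n} F)))
      * expect p I (\<lambda>F. of_bool (colourable k {1..n} F)) \<le> exp (\<theta>\<^sup>2 * real n - \<theta> * b)"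
proof -
  define Y where "Y = (\<lambda>F. real (defect k {1..n} F))"
  \<comment> \<open>Each edge belongs to its larger end \<open>Suc i\<close>: the blocks are
    disjoint, and each lies in the star of one vertex.\<close>
  define B where "B = (\<lambda>i. {e \<in> all_edges {1..n}. Max e = Suc i})"
  have edge: "finite e" "e \<noteq> {}" "e \<subseteq> {1..n}" if "e \<in> all_edges {1..n}" for e
    using that finite_subset[of e "{1..n}"] by (auto simp: all_edges_def)
  have I: "I = (\<Union>i<n. B i)"
  proof
    show "I \<subseteq> (\<Union>i<n. B i)"
    proof
      fix e assume e: "e \<in> I"
      hence "Max e \<in> e" "e \<subseteq> {1..n}" using edge[of e] by (simp_all add: I_def)
      hence "Max e \<in> {1..n}" by blast
      hence "Max e - 1 < n" "Max e = Suc (Max e - 1)" by auto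
      thus "e \<in> (\<Union>i<n. B i)" using e by (auto simp: B_def I_def)
    qed
  qed (auto simp: B_def I_def)
  have finI: "finite I" by (simp add: I_def finite_all_edges)
  have conc: "expect p I (\<lambda>F. exp (\<theta> * Y F)) * expect p I (\<lambda>F. exp (- \<theta> * Y F)) \<le> cosh \<theta> ^ n"
    unfolding I
  proof (rule expect_exp_blocks[OF p])
    fix i F F' assume i: "i < n" "F - B i = F' - B i"
    have "defect k {1..n} F \<le> defect k {1..n} F' + 1"
    proof (rule defect_vertex_change)
      fix e assume "e \<in> B i"
      hence e: "e \<in> all_edges {1..n}" "Max e = Suc i" by (simp_all add: B_def)
      show "Suc i \<in> e" using Max_in[OF edge(1,2)[OF e(1)]] e(2) by simp
    qed (use i in auto)
    thus "Y F \<le> Y F' + 1" by (simp add: Y_def)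
  qed (auto simp: B_def finite_all_edges \<theta>)
  have "expect p I (\<lambda>F. of_bool (b \<le> Y F)) * exp (\<theta> * b) = expect p I (\<lambda>F. of_bool (b \<le> Y F) * exp (\<theta> * b))"
    by (simp add: expect_cmult_right)
  also have "\<dots> \<le> expect p I (\<lambda>F. exp (\<theta> * Y F))"
    using p \<theta> by (intro expect_mono) (auto simp: mult_left_mono)
  finally have 1: "expect p I (\<lambda>F. of_bool (b \<le> Y F)) * exp (\<theta> * b) \<le> expect p I (\<lambda>F. exp (\<theta> * Y F))" .
  have 2: "expect p I (\<lambda>F. of_bool (colourable k {1..n} F)) \<le> expect p I (\<lambda>F. exp (- \<theta> * Y F))"
    using p by (intro expect_mono) (auto simp: Y_def defect_eq_0)
  have "(expect p I (\<lambda>F. of_bool (b \<le> Y F)) * exp (\<theta> * b)) * expect p I (\<lambda>F. of_bool (colourable k {1..n} F))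
      \<le> expect p I (\<lambda>F. exp (\<theta> * Y F)) * expect p I (\<lambda>F. exp (- \<theta> * Y F))"
    using 1 2 p by (intro mult_mono expect_nonneg) auto
  also have "\<dots> \<le> cosh \<theta> ^ n" by (rule conc)
  also have "\<dots> \<le> exp (\<theta>\<^sup>2) ^ n"
    using \<theta> by (intro power_mono cosh_le_exp_square) (auto simp: cosh_real_nonneg)
  also have "\<dots> = exp (\<theta>\<^sup>2 * real n)" by (simp add: mult.commute flip: exp_of_nat_mult)
  finally show ?thesis by (simp add: Y_def exp_diff field_simps)
qed

section \<open>Small vertex sets are sparse\<close>

lemma square_le_power_two: "10 \<le> h \<Longrightarrow> real h ^ 2 \<le> 2 ^ (h - 3)"
proof (induction h rule: dec_induct)
  case (step h)
  have "real (Suc h) ^ 2 \<le> 2 * real h ^ 2"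
  proof -
    have "3 * real h \<le> real h * real h" using step(1) by (intro mult_right_mono) auto
    hence "1 + 2 * real h \<le> real h * real h" using step(1) by linarith
    thus ?thesis by (simp add: power2_eq_square algebra_simps)
  qed
  also have "\<dots> \<le> 2 * 2 ^ (h - 3)" using step by simp
  also have "\<dots> = 2 ^ (Suc h - 3)" using step(1) by (simp add: Suc_diff_le flip: power_Suc)
  finally show ?case .
qed simp

text \<open>Union bound over the sets \<open>S\<close> of each size \<open>s\<close> and over the
  choices of \<open>h * s\<close> edges inside \<open>S\<close>.\<close>

lemma prob_dense_spot:
  fixes p d :: real and n h :: nat
  assumes p: "0 < p" "p < 1" and d: "1 \<le> d" "d = real n * p"
    and h: "12 * d powr (3/4) \<le> real h"
  shows "expect p (all_edges {1..n}) (\<lambda>F. of_bool (\<exists>S\<subseteq>{1..n}. S \<noteq> {} \<and>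
      real (card S) \<le> 4 * real n * d powr (- 1/4) \<and> h * card S \<le> card {e \<in> F. e \<subseteq> S})) \<le> 6 * p"
proof -
  define I where "I = all_edges {1..n}"
  define u where "u = 4 * real n * d powr (- 1/4)"
  have finI: "finite I" by (simp add: I_def finite_all_edges)
  have d34: "1 \<le> d powr (3/4)" using d by (simp add: ge_one_powr_ge_zero)
  have h12: "12 \<le> real h" using h d34 by linarith
  \<comment> \<open>Later \<open>h - 3\<close> halvings have to absorb a factor
    \<open>d\<close>.\<close>
  have dh: "d \<le> 2 ^ (h - 3)"
  proof -
    have "d = d powr (3/4) * d powr (1/4)" using d by (simp flip: powr_add)
    also have "\<dots> \<le> d powr (3/4) * d powr (3/4)" using d by (intro mult_left_mono powr_mono) auto
    also have "\<dots> \<le> real h * real h" using h d34 by (intro mult_mono) auto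
    also have "\<dots> \<le> 2 ^ (h - 3)" using square_le_power_two[of h] h12 by (simp add: power2_eq_square)
    finally show ?thesis .
  qed
  have bound: "expect p I (\<lambda>F. of_bool (h * card S \<le> card {e \<in> F. e \<subseteq> S}))
      \<le> (exp 1 * real s * p / (2 * real h)) ^ (h * s)"
    if S: "S \<subseteq> {1..n}" "card S = s" "0 < s" for S s
  proof -
    define M where "M = h * s"
    have M: "0 < M" using h12 S by (auto simp: M_def)
    have finS: "finite S" using S finite_subset by auto
    define \<A> where "\<A> = {A. A \<subseteq> all_edges S \<and> card A = M}"
    have fin\<A>: "finite \<A>" unfolding \<A>_def
      by (rule finite_subset[of _ "Pow (all_edges S)"]) (auto simp: finite_all_edges finS)
    have SI: "all_edges S \<subseteq> I" unfolding I_def by (rule all_edges_mono[OF S(1)])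
    have "expect p I (\<lambda>F. of_bool (h * card S \<le> card {e \<in> F. e \<subseteq> S})) \<le> expect p I (\<lambda>F. \<Sum>A\<in>\<A>. of_bool (A \<subseteq> F))"
    proof (intro expect_mono)
      fix F assume F: "F \<subseteq> I"
      show "of_bool (h * card S \<le> card {e \<in> F. e \<subseteq> S}) \<le> (\<Sum>A\<in>\<A>. of_bool (A \<subseteq> F) :: real)"
      proof (cases "h * card S \<le> card {e \<in> F. e \<subseteq> S}")
        case True
        hence "M \<le> card {e \<in> F. e \<subseteq> S}" using S by (simp add: M_def)
        then obtain A where A: "A \<subseteq> {e \<in> F. e \<subseteq> S}" "card A = M"
          by (rule obtain_subset_with_card_n)
        have "A \<in> \<A>" using A F by (auto simp: \<A>_def I_def all_edges_def)
        hence "(\<Sum>A\<in>{A}. of_bool (A \<subseteq> F)) \<le> (\<Sum>A\<in>\<A>. of_bool (A \<subseteq> F) :: real)"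
          using fin\<A> by (intro sum_mono2) auto
        moreover have "A \<subseteq> F" using A by auto
        ultimately show ?thesis by simp
      qed (simp add: sum_nonneg)
    qed (use p in auto)
    also have "\<dots> = (\<Sum>A\<in>\<A>. p ^ M)"
      unfolding expect_sum using SI finI
      by (intro sum.cong refl) (auto simp: \<A>_def expect_contain)
    also have "\<dots> = real (card (all_edges S) choose M) * p ^ M"
      unfolding \<A>_def using n_subsets[of "all_edges S" M] finS by (simp add: finite_all_edges)
    also have "\<dots> \<le> (exp 1 * real (s choose 2) / real M) ^ M * p ^ M"
      using p M finS S by (intro mult_right_mono) (auto simp: card_all_edges binomial_le_exp_power)
    also have "\<dots> = (exp 1 * real (s choose 2) / real M * p) ^ M" by (rule power_mult_distrib[symmetric])
    also have "\<dots> \<le> (exp 1 * real s * p / (2 * real h)) ^ M"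
    proof (intro power_mono)
      have "real (s choose 2) \<le> real s * real s / 2" by (simp add: real_choose_two field_simps)
      hence "exp 1 * real (s choose 2) / real M * p \<le> exp 1 * (real s * real s / 2) / real M * p"
        using p by (intro mult_right_mono divide_right_mono mult_left_mono) auto
      thus "exp 1 * real (s choose 2) / real M * p \<le> exp 1 * real s * p / (2 * real h)"
        using S by (simp add: M_def field_simps)
    qed (use p in auto)
    finally show ?thesis by (simp add: M_def)
  qed
  have sum_s: "real (n choose s) * (exp 1 * real s * p / (2 * real h)) ^ (h * s) \<le> p * (real s * (1 / 2) ^ s)"
    if s: "0 < s" "real s \<le> u" for s
  proof -
    define y where "y = exp 1 * real s * p / (2 * real h)"
    have y0: "0 < y" using s p h12 by (simp add: y_def)
    have d41: "d powr (- 1/4) * d = d powr (3/4)"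
    proof -
      have "d powr (- 1/4 + 1) = d powr (- 1/4) * d powr 1" by (rule powr_add)
      thus ?thesis using d(1) by simp
    qed
    \<comment> \<open>The 12 in \<open>h\<close> is 3, for \<open>exp 1\<close>, times the 4 in
      \<open>u\<close>.\<close>
    have y_half: "y \<le> 1 / 2"
    proof -
      have "exp 1 * (real s * p) \<le> 3 * (u * p)"
        using s p exp_le by (intro mult_mono) auto
      also have "u * p = 4 * (d powr (- 1/4) * d)" by (simp add: u_def d(2))
      also have "3 * (4 * (d powr (- 1/4) * d)) = 12 * d powr (3/4)" unfolding d41 by simp
      also have "\<dots> \<le> real h" by (rule h)
      finally show ?thesis using h12 by (simp add: y_def field_simps)
    qed
    have ye: "y \<le> p * real s"
    proof -
      have "exp 1 * (real s * p) \<le> (2 * real h) * (real s * p)"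
        using exp_le h12 p by (intro mult_right_mono) auto
      thus ?thesis using h12 by (simp add: y_def field_simps)
    qed
    have "real (n choose s) * y ^ (h * s) \<le> (exp 1 * real n / real s) ^ s * (y ^ h) ^ s"
      unfolding power_mult using y0 s by (intro mult_right_mono binomial_le_exp_power) auto
    also have "\<dots> = (exp 1 * real n / real s * y ^ h) ^ s" by (rule power_mult_distrib[symmetric])
    \<comment> \<open>Of the \<open>h\<close> factors \<open>y\<close>, one turns
      \<open>n / s\<close> into at most \<open>d\<close>, the next \<open>h - 2\<close> are halvings
      that absorb this \<open>d\<close> and leave \<open>1 / 2\<close>, and the last one survives to
      provide the factor \<open>p\<close> of the error.\<close>
    also have "\<dots> \<le> (y / 2) ^ s"
    proof (intro power_mono)
      have hh: "h = Suc (Suc (h - 2))" "h - 2 = Suc (h - 3)" using h12 by auto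
      have "exp 1 * real n / real s * y = exp 1 * exp 1 * d / (2 * real h)"
        using s by (simp add: y_def d(2))
      also have "\<dots> \<le> 3 * 3 * d / (2 * real h)"
        using exp_le d h12 by (intro divide_right_mono mult_right_mono mult_mono) auto
      also have "\<dots> \<le> d"
      proof -
        have "9 * d \<le> (2 * real h) * d" using h12 d(1) by (intro mult_right_mono) auto
        thus ?thesis using h12 by (simp add: field_simps)
      qed
      finally have K: "exp 1 * real n / real s * y \<le> d" .
      have "exp 1 * real n / real s * y ^ h = (exp 1 * real n / real s * y) * y ^ (h - 2) * y"
      proof -
        have "y ^ h = y * y ^ (h - 2) * y" by (metis hh(1) power_Suc power_Suc2 mult.commute)
        thus ?thesis by simp
      qed
      also have "\<dots> \<le> d * (1 / 2) ^ (h - 2) * y"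
        using K y0 y_half d by (intro mult_right_mono mult_mono power_mono) auto
      also have "d * (1 / 2) ^ (h - 2) = d / 2 ^ (h - 3) / 2"
        unfolding hh(2) by (simp add: power_divide)
      also have "\<dots> * y \<le> 1 / 2 * y" using dh y0 by (intro mult_right_mono) (auto simp: field_simps)
      finally show "exp 1 * real n / real s * y ^ h \<le> y / 2" by simp
    qed (use y0 in auto)
    also have "\<dots> = y ^ s * (1 / 2) ^ s" by (simp add: power_divide)
    also have "\<dots> \<le> y * (1 / 2) ^ s"
    proof -
      have "y ^ s \<le> y ^ 1" using s y0 y_half by (intro power_decreasing) auto
      thus ?thesis by simp
    qed
    also have "\<dots> \<le> p * real s * (1 / 2) ^ s" using ye by (intro mult_right_mono) auto
    finally show ?thesis by (simp add: y_def mult_ac)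
  qed
  define \<S> where "\<S> = (\<lambda>s. {S. S \<subseteq> {1..n} \<and> card S = s})"
  have fin\<S>: "finite (\<S> s)" for s unfolding \<S>_def
    by (rule finite_subset[of _ "Pow {1..n}"]) auto
  define T where "T = {s \<in> {1..n}. real s \<le> u}"
  have "expect p I (\<lambda>F. of_bool (\<exists>S\<subseteq>{1..n}. S \<noteq> {} \<and> real (card S) \<le> u \<and> h * card S \<le> card {e \<in> F. e \<subseteq> S}))
      \<le> expect p I (\<lambda>F. \<Sum>s\<in>T. \<Sum>S\<in>\<S> s. of_bool (h * card S \<le> card {e \<in> F. e \<subseteq> S}))"
  proof (intro expect_mono)
    fix F
    show "of_bool (\<exists>S\<subseteq>{1..n}. S \<noteq> {} \<and> real (card S) \<le> u \<and> h * card S \<le> card {e \<in> F. e \<subseteq> S})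
        \<le> (\<Sum>s\<in>T. \<Sum>S\<in>\<S> s. of_bool (h * card S \<le> card {e \<in> F. e \<subseteq> S}) :: real)"
    proof (cases "\<exists>S\<subseteq>{1..n}. S \<noteq> {} \<and> real (card S) \<le> u \<and> h * card S \<le> card {e \<in> F. e \<subseteq> S}")
      case True
      then obtain S where S: "S \<subseteq> {1..n}" "S \<noteq> {}" "real (card S) \<le> u" "h * card S \<le> card {e \<in> F. e \<subseteq> S}"
        by blast
      have "card S \<le> n" using card_mono[OF _ S(1)] by simp
      moreover have "0 < card S" using S finite_subset[OF S(1)] by (simp add: card_gt_0_iff)
      ultimately have T: "card S \<in> T" using S by (auto simp: T_def)
      have "1 = (\<Sum>S\<in>{S}. of_bool (h * card S \<le> card {e \<in> F. e \<subseteq> S}) :: real)" using S by simp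
      also have "\<dots> \<le> (\<Sum>S\<in>\<S> (card S). of_bool (h * card S \<le> card {e \<in> F. e \<subseteq> S}))"
        using fin\<S> S by (intro sum_mono2) (auto simp: \<S>_def)
      also have "\<dots> = (\<Sum>s\<in>{card S}. \<Sum>S\<in>\<S> s. of_bool (h * card S \<le> card {e \<in> F. e \<subseteq> S}))" by simp
      also have "\<dots> \<le> (\<Sum>s\<in>T. \<Sum>S\<in>\<S> s. of_bool (h * card S \<le> card {e \<in> F. e \<subseteq> S}))"
        using T by (intro sum_mono2) (auto simp: T_def intro!: sum_nonneg)
      finally show ?thesis using True by simp
    qed (auto intro!: sum_nonneg)
  qed (use p in auto)
  also have "\<dots> = (\<Sum>s\<in>T. \<Sum>S\<in>\<S> s. expect p I (\<lambda>F. of_bool (h * card S \<le> card {e \<in> F. e \<subseteq> S})))"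
    by (simp add: expect_sum)
  also have "\<dots> \<le> (\<Sum>s\<in>T. \<Sum>S\<in>\<S> s. (exp 1 * real s * p / (2 * real h)) ^ (h * s))"
    by (intro sum_mono bound) (auto simp: T_def \<S>_def)
  also have "\<dots> = (\<Sum>s\<in>T. real (n choose s) * (exp 1 * real s * p / (2 * real h)) ^ (h * s))"
    by (simp add: \<S>_def n_subsets)
  also have "\<dots> \<le> (\<Sum>s\<in>T. p * (real s * (1 / 2) ^ s))"
    by (intro sum_mono sum_s) (auto simp: T_def)
  also have "\<dots> = p * (\<Sum>s\<in>T. real s * (1 / 2) ^ s)" by (simp add: sum_distrib_left)
  also have "(\<Sum>s\<in>T. real s * (1 / 2) ^ s) \<le> (\<Sum>s\<le>n. real s * (1 / 2) ^ s)"
    by (intro sum_mono2) (auto simp: T_def)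
  also have "\<dots> \<le> 2"
  proof -
    have "(\<Sum>s\<le>n. real s * (1 / 2) ^ s) = 2 - (real n + 2) * (1 / 2) ^ n"
      by (induction n) (auto simp: field_simps)
    thus ?thesis by simp
  qed
  finally show ?thesis using p by (simp add: I_def u_def mult_left_mono)
qed

section \<open>Tails of the improper chromatic number\<close>

lemma prob_chromatic_large:
  fixes d p x L :: real and k h n t :: nat
  assumes dn: "d = real n * p" and p: "0 < p" "p \<le> 1 / 2"
    and x: "0 < x" "x \<le> 1 / 8" and px: "p \<le> x\<^sup>2 / 8" "2 * p \<le> x" "2 * p \<le> exp (- 6)"
    and d: "1 < d" and L_def: "L = ln d" and dL: "2 \<le> d * L"
    and k: "(1 + 8 * x) * d / (2 * L) \<le> real k" "real k \<le> d / L"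
    and h: "12 * d powr (3/4) \<le> real h"
    and c0: "2 * d powr (- 1/4) \<le> 1"
    and c1: "2 * exp 1 * L * exp (- x * L) \<le> exp (- 1)"
    and c2: "exp 3 * (4 * L\<^sup>2 / d) \<le> 2"
    and c3: "500 * L\<^sup>2 \<le> sqrt d"
    and c4: "exp 3 * (4 * L\<^sup>2) + 6 * d * exp (- sqrt d) \<le> sqrt d"
    and c5: "sqrt d * (4 * L\<^sup>2 / d) \<le> exp (- 6)"
  shows "expect p (all_edges {1..n}) (\<lambda>F. of_bool (k + 2 * h < t_improper_chromatic t {1..n} F))
    \<le> 2 * exp (- (1 / p)) + 6 * p"
proof -
  define I where "I = all_edges {1..n}"
  define V where "V = {1..n}"
  define u where "u = 4 * real n * d powr (- 1/4)"
  define r where "r = - ln (1 - p)"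
  have r: "r \<le> p + 2 * p\<^sup>2" using ln_one_minus_pos_lower_bound[of p] p by (simp add: r_def)
  have "p * (2 * p) \<le> p * x" using p px by (intro mult_left_mono) auto
  moreover have "p * (2 * p) \<le> p * 1" using p by (intro mult_left_mono) auto
  moreover have "2 * p\<^sup>2 = p * (2 * p)" "(1 + x) * p = p + p * x" by (simp_all add: power2_eq_square algebra_simps)
  ultimately have rp: "r \<le> (1 + x) * p" and r_small: "r \<le> exp (- 6)" using r px(3) by linarith+
  define P0 where "P0 = expect p I (\<lambda>F. of_bool (colourable k V F))"
  define P1 where "P1 = expect p I (\<lambda>F. of_bool (u \<le> real (defect k V F)))"
  have P0: "exp (- (sqrt d / p)) / 2 \<le> P0"
    unfolding P0_def I_def V_def
    by (rule prob_colourable_ge[of _ d p r x L k]) (use dn p r_def r_small rp x px d L_def dL k c1 c2 c3 c4 c5 in auto)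
  have P10: "0 \<le> P1" unfolding P1_def using p by (intro expect_nonneg) auto
  \<comment> \<open>With \<open>u\<close> as above, \<open>\<theta>\<^sup>2 * n\<close> is 4 and
    \<open>\<theta> * u\<close> is 8 times \<open>sqrt d / p\<close>. The net exponent of -4 remains
    at -3 after division by \<open>P0\<close>.\<close>
  define \<theta> where "\<theta> = 2 * d powr (- 1/4)"
  have half: "d powr (- 1/4) * d powr (- 1/4) * real n = sqrt d / p"
  proof -
    have "d powr (- 1/4) * d powr (- 1/4) = d powr (- 1/2)" by (simp flip: powr_add)
    also have "\<dots> = 1 / sqrt d" using d by (simp add: powr_minus_divide powr_half_sqrt)
    finally have "d powr (- 1/4) * d powr (- 1/4) * real n = real n / sqrt d" by simp
    also have "\<dots> = d / p / sqrt d" using dn p by simp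
    also have "\<dots> = d / sqrt d / p" by (simp add: mult.commute)
    also have "\<dots> = sqrt d / p" using d by (subst real_div_sqrt) auto
    finally show ?thesis .
  qed
  have "\<theta>\<^sup>2 * real n = 4 * (d powr (- 1/4) * d powr (- 1/4) * real n)"
    by (simp add: \<theta>_def power2_eq_square)
  moreover have "\<theta> * u = 8 * (d powr (- 1/4) * d powr (- 1/4) * real n)"
    by (simp add: \<theta>_def u_def)
  ultimately have expo: "\<theta>\<^sup>2 * real n - \<theta> * u = - 4 * (sqrt d / p)" unfolding half by simp
  have "P1 * P0 \<le> exp (\<theta>\<^sup>2 * real n - \<theta> * u)"
    unfolding P1_def P0_def I_def V_def using p c0 by (intro prob_defect_large) (auto simp: \<theta>_def)
  hence "P1 * P0 \<le> exp (- 4 * (sqrt d / p))" unfolding expo .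
  moreover have "P1 * (exp (- (sqrt d / p)) / 2) \<le> P1 * P0" using P0 P10 by (rule mult_left_mono)
  ultimately have "P1 * (exp (- (sqrt d / p)) / 2) \<le> exp (- 4 * (sqrt d / p))" by linarith
  also have "- 4 * (sqrt d / p) = - 3 * (sqrt d / p) + - (sqrt d / p)" by simp
  also have "exp \<dots> = exp (- 3 * (sqrt d / p)) * exp (- (sqrt d / p))" by (rule exp_add)
  finally have "P1 \<le> 2 * exp (- 3 * (sqrt d / p))" by simp
  also have "\<dots> \<le> 2 * exp (- (1 / p))"
  proof -
    have "1 \<le> sqrt d" using d by simp
    hence "1 / p \<le> sqrt d / p" using p by (intro divide_right_mono) auto
    moreover have "0 \<le> sqrt d / p" using p d by simp
    ultimately have "1 / p \<le> 3 * (sqrt d / p)" by linarith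
    thus ?thesis by simp
  qed
  finally have P1: "P1 \<le> 2 * exp (- (1 / p))" .
  define D where "D = (\<lambda>F. \<exists>S\<subseteq>V. S \<noteq> {} \<and> real (card S) \<le> u \<and> h * card S \<le> card {e \<in> F. e \<subseteq> S})"
  have P2: "expect p I (\<lambda>F. of_bool (D F)) \<le> 6 * p"
    unfolding I_def D_def V_def u_def using p d dn h by (intro prob_dense_spot) auto
  have "expect p I (\<lambda>F. of_bool (k + 2 * h < t_improper_chromatic t V F))
      \<le> expect p I (\<lambda>F. of_bool (u \<le> real (defect k V F)) + of_bool (D F))"
  proof (intro expect_mono)
    fix F assume F: "F \<subseteq> I"
    have "t_improper_chromatic t V F \<le> k + 2 * h" if def: "real (defect k V F) < u" and nD: "\<not> D F"
    proof (rule t_improper_chromatic_le)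
      obtain U where U: "U \<subseteq> V" "card U = defect k V F" "colourable k (V - U) F" by (rule defect_attained)
      have finU: "finite U" using U by (auto simp: V_def intro: finite_subset)
      \<comment> \<open>Fewer than \<open>h\<close> edges per vertex mean average degree below
        \<open>2 * h\<close>.\<close>
      have "colourable (2 * h) U F"
      proof (rule colourable_sparse[OF finU])
        show "F \<subseteq> all_edges {1..n}" using F by (simp add: I_def)
        fix S assume S: "S \<subseteq> U" "S \<noteq> {}"
        have "card S \<le> card U" using S finU by (intro card_mono)
        hence "real (card S) \<le> u" using U(2) def by simp
        moreover have "S \<subseteq> V" using S U by blast
        ultimately have "\<not> h * card S \<le> card {e \<in> F. e \<subseteq> S}" using nD S unfolding D_def by blast
        thus "2 * card {e \<in> F. e \<subseteq> S} < 2 * h * card S" by simp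
      qed
      moreover have "V - (V - U) = U" using U by blast
      ultimately show "colourable (k + 2 * h) V F" using U by (intro colourable_union[of k "V - U"]) auto
    qed (use F in \<open>simp add: I_def V_def\<close>)
    thus "of_bool (k + 2 * h < t_improper_chromatic t V F)
        \<le> (of_bool (u \<le> real (defect k V F)) + of_bool (D F) :: real)" by (auto simp: not_less)
  qed (use p in auto)
  also have "\<dots> \<le> 2 * exp (- (1 / p)) + 6 * p" unfolding expect_add using P1 P2 by (simp add: P1_def)
  finally show ?thesis by (simp add: I_def V_def)
qed

section \<open>Lower bound: first moment over vertex sets\<close>

lemma t_dependent_set_exists:
  fixes m :: nat
  assumes V: "finite V" and F: "F \<subseteq> all_edges V"
    and le: "real (t_improper_chromatic t V F) * real m < real (card V)"
  obtains S where "S \<subseteq> V" "card S = m" "t_dependent t F S"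
proof -
  define K where "K = t_improper_chromatic t V F"
  obtain c where c: "t_improper_colouring t V F K c"
    unfolding K_def using V F by (rule t_improper_colouring_chromatic)
  have finF: "finite F" using F V finite_all_edges finite_subset by blast
  \<comment> \<open>Pigeonhole; the class is then cut down to exactly \<open>m\<close> vertices, as
    \<open>t\<close>-dependence is hereditary.\<close>
  have "\<exists>i<K. m \<le> card {v \<in> V. c v = i}"
  proof (rule ccontr)
    assume "\<not> ?thesis"
    hence small: "card {v \<in> V. c v = i} \<le> m" if "i < K" for i using that by (auto simp: not_le)
    have "V = (\<Union>i<K. {v \<in> V. c v = i})" using c by (auto simp: t_improper_colouring_def)
    hence "card V = card (\<Union>i<K. {v \<in> V. c v = i})" by simp
    also have "\<dots> \<le> (\<Sum>i<K. card {v \<in> V. c v = i})" by (intro card_UN_le) auto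
    also have "\<dots> \<le> (\<Sum>i<K. m)" using small by (intro sum_mono) auto
    finally have "card V \<le> K * m" by simp
    hence "real (card V) \<le> real K * real m" by (metis of_nat_le_iff of_nat_mult)
    thus False using le by (simp add: K_def)
  qed
  then obtain i where i: "i < K" "m \<le> card {v \<in> V. c v = i}" by blast
  from i(2) obtain S where S: "S \<subseteq> {v \<in> V. c v = i}" "card S = m" by (rule obtain_subset_with_card_n)
  have "t_dependent t F {v \<in> V. c v = i}" using c i by (auto simp: t_improper_colouring_def)
  hence "t_dependent t F S" using S(1) finF by (rule t_dependent_subset)
  thus ?thesis using S that by blast
qed

text \<open>Chernoff bound for the lower tail, by Markov's inequality for
  \<open>exp (- \<theta>)\<close> to the number of edges.\<close>

lemma prob_few_edges:
  assumes I: "finite I" "A \<subseteq> I" and p: "0 \<le> p" "p \<le> 1" and \<theta>: "0 \<le> \<theta>"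
  shows "expect p I (\<lambda>F. of_bool (card (F \<inter> A) \<le> b))
    \<le> exp (\<theta> * real b - p * (1 - exp (- \<theta>)) * real (card A))"
proof -
  have "expect p I (\<lambda>F. of_bool (card (F \<inter> A) \<le> b)) \<le> expect p I (\<lambda>F. exp (\<theta> * real b) * exp (- \<theta>) ^ card (F \<inter> A))"
  proof (intro expect_mono p)
    fix F
    show "of_bool (card (F \<inter> A) \<le> b) \<le> exp (\<theta> * real b) * exp (- \<theta>) ^ card (F \<inter> A)"
    proof (cases "card (F \<inter> A) \<le> b")
      case True
      hence "\<theta> * real (card (F \<inter> A)) \<le> \<theta> * real b" using \<theta> by (intro mult_left_mono) auto
      hence "0 \<le> \<theta> * real b - \<theta> * real (card (F \<inter> A))" by simp
      hence "1 \<le> exp (\<theta> * real b - \<theta> * real (card (F \<inter> A)))" by (simp only: one_le_exp_iff)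
      also have "\<dots> = exp (\<theta> * real b) * exp (- \<theta>) ^ card (F \<inter> A)"
        by (simp add: mult.commute flip: exp_of_nat_mult exp_add)
      finally show ?thesis by simp
    qed simp
  qed
  also have "\<dots> = exp (\<theta> * real b) * (1 - p + p * exp (- \<theta>)) ^ card A"
    by (simp add: expect_cmult expect_exp_card[OF I])
  also have "\<dots> \<le> exp (\<theta> * real b) * exp (- (p * (1 - exp (- \<theta>)))) ^ card A"
  proof (intro mult_left_mono power_mono)
    show "1 - p + p * exp (- \<theta>) \<le> exp (- (p * (1 - exp (- \<theta>))))"
      using exp_ge_add_one_self[of "- (p * (1 - exp (- \<theta>)))"] by (simp add: algebra_simps)
  qed (use p in auto)
  also have "\<dots> = exp (\<theta> * real b - p * (1 - exp (- \<theta>)) * real (card A))"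
    unfolding exp_of_nat_mult[symmetric] exp_add[symmetric] by (simp add: algebra_simps)
  finally show ?thesis .
qed

text \<open>There are at most \<open>exp (m * L)\<close> candidate sets of size \<open>m\<close>,
  and each has at least \<open>(1 + \<epsilon> / 2) * m * L\<close> expected edges. The choice
  \<open>exp (- \<theta>) = \<epsilon> / 8\<close> keeps a share \<open>1 - \<epsilon> / 8\<close>
  of these in the Chernoff exponent, and tolerating \<open>t * m\<close> edges costs
  \<open>\<theta> * t\<close> per vertex. The bound on \<open>t\<close> limits this cost to
  \<open>\<epsilon> / 8 * L\<close>.\<close>

lemma prob_chromatic_small:
  fixes d p \<epsilon> L \<theta> :: real and n t :: nat
  assumes dn: "d = real n * p" and p: "0 < p" "p \<le> 1 / 2" and \<epsilon>: "0 < \<epsilon>" "\<epsilon> \<le> 1 / 2"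
    and p\<epsilon>: "2 * p \<le> \<epsilon>" and d: "1 < d" and L_def: "L = ln d" and L: "3 / 2 \<le> L"
    and \<theta>_def: "\<theta> = ln (8 / \<epsilon>)" and t: "real t \<le> \<epsilon> / (8 * \<theta>) * L"
  shows "expect p (all_edges {1..n}) (\<lambda>F. of_bool (real (t_improper_chromatic t {1..n} F) < (1 - \<epsilon>) * (d / (2 * L))))
    \<le> exp (- (\<epsilon> / 8 / p))"
proof -
  define I where "I = all_edges {1..n}"
  have finI: "finite I" by (simp add: I_def finite_all_edges)
  have \<theta>0: "0 < \<theta>" using \<epsilon> by (simp add: \<theta>_def)
  have e\<theta>: "exp (- \<theta>) = \<epsilon> / 8" using \<epsilon> by (simp add: \<theta>_def exp_minus)
  define a where "a = 2 * L / ((1 - \<epsilon>) * p)"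
  have a0: "0 \<le> a" using L \<epsilon> p by (simp add: a_def)
  define m where "m = nat \<lfloor>a\<rfloor>"
  have m_le: "real m \<le> a" unfolding m_def using a0 by simp
  have m_ge: "a - 1 \<le> real m" unfolding m_def using a0 by linarith
  have a_ge: "2 * (1 + \<epsilon>) * L / p \<le> a"
  proof -
    have "(1 + \<epsilon>) * (1 - \<epsilon>) \<le> 1" by (simp add: algebra_simps)
    hence "(1 + \<epsilon>) \<le> 1 / (1 - \<epsilon>)" using \<epsilon> by (simp add: pos_le_divide_eq)
    hence "(1 + \<epsilon>) * (2 * L / p) \<le> 1 / (1 - \<epsilon>) * (2 * L / p)" using L p by (intro mult_right_mono) auto
    thus ?thesis by (simp add: a_def mult_ac)
  qed
  have "2 \<le> \<epsilon> / p" using p p\<epsilon> by (simp add: field_simps)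
  hence "2 * 1 \<le> \<epsilon> / p * L" using L by (intro mult_mono) auto
  \<comment> \<open>Half of the margin \<open>\<epsilon>\<close> absorbs two units: the rounding of
    \<open>a\<close> and the \<open>m - 1\<close> in \<open>m choose 2\<close>.\<close>
  hence \<epsilon>Lp: "2 \<le> \<epsilon> * L / p" by simp
  have m1: "2 * (1 + \<epsilon> / 2) * L / p \<le> real m - 1"
  proof -
    have "2 * (1 + \<epsilon>) * L / p = 2 * (1 + \<epsilon> / 2) * L / p + \<epsilon> * L / p"
      using p by (simp add: field_simps)
    thus ?thesis using m_ge a_ge \<epsilon>Lp by linarith
  qed
  have m2: "2 * L / p \<le> real m"
  proof -
    have "2 * (1 + \<epsilon> / 2) * L / p = 2 * L / p + \<epsilon> * L / p" using p by (simp add: field_simps)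
    thus ?thesis using m1 \<epsilon>Lp by linarith
  qed
  have mpos: "0 < real m" using m2 L p by (smt (verit) divide_pos_pos)
  define \<S> where "\<S> = {S. S \<subseteq> {1..n} \<and> card S = m}"
  have fin\<S>: "finite \<S>" unfolding \<S>_def by (rule finite_subset[of _ "Pow {1..n}"]) auto
  have "expect p I (\<lambda>F. of_bool (real (t_improper_chromatic t {1..n} F) < (1 - \<epsilon>) * (d / (2 * L))))
      \<le> expect p I (\<lambda>F. \<Sum>S\<in>\<S>. of_bool (card (F \<inter> all_edges S) \<le> t * m))"
  proof (intro expect_mono)
    fix F assume F: "F \<subseteq> I"
    define K where "K = t_improper_chromatic t {1..n} F"
    show "of_bool (real K < (1 - \<epsilon>) * (d / (2 * L))) \<le> (\<Sum>S\<in>\<S>. of_bool (card (F \<inter> all_edges S) \<le> t * m) :: real)"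
    proof (cases "real K < (1 - \<epsilon>) * (d / (2 * L))")
      case True
      have "real K * real m < (1 - \<epsilon>) * (d / (2 * L)) * real m" using True mpos by (rule mult_strict_right_mono)
      also have "\<dots> \<le> (1 - \<epsilon>) * (d / (2 * L)) * a" using m_le \<epsilon> d L by (intro mult_left_mono) auto
      also have "\<dots> = real n" using \<epsilon> L p by (simp add: a_def dn)
      finally have "real (t_improper_chromatic t {1..n} F) * real m < real (card {1..n})" by (simp add: K_def)
      then obtain S where S: "S \<subseteq> {1..n}" "card S = m" "t_dependent t F S"
        by (rule t_dependent_set_exists[OF finite_atLeastAtMost F[unfolded I_def]])
      have finS: "finite S" using S finite_subset by auto
      have "card (F \<inter> all_edges S) \<le> t * card S"
        using S(3) finS F unfolding I_def by (rule t_dependent_card_edges)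
      hence "1 = (\<Sum>S\<in>{S}. of_bool (card (F \<inter> all_edges S) \<le> t * m) :: real)" using S by simp
      also have "\<dots> \<le> (\<Sum>S\<in>\<S>. of_bool (card (F \<inter> all_edges S) \<le> t * m))"
        using S fin\<S> by (intro sum_mono2) (auto simp: \<S>_def)
      finally show ?thesis using True by simp
    qed (simp add: sum_nonneg)
  qed (use p in auto)
  also have "\<dots> = (\<Sum>S\<in>\<S>. expect p I (\<lambda>F. of_bool (card (F \<inter> all_edges S) \<le> t * m)))" by (rule expect_sum)
  also have "\<dots> \<le> (\<Sum>S\<in>\<S>. exp (real m * (\<epsilon> / 8 * L - (1 + \<epsilon> / 2) * (1 - \<epsilon> / 8) * L)))"
  proof (intro sum_mono)
    fix S assume "S \<in> \<S>"
    hence S: "S \<subseteq> {1..n}" "card S = m" by (auto simp: \<S>_def)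
    have finS: "finite S" using S finite_subset by auto
    have "expect p I (\<lambda>F. of_bool (card (F \<inter> all_edges S) \<le> t * m))
        \<le> exp (\<theta> * real (t * m) - p * (1 - exp (- \<theta>)) * real (card (all_edges S)))"
      using finI p \<theta>0 all_edges_mono[OF S(1)] by (intro prob_few_edges) (auto simp: I_def)
    also have "\<dots> \<le> exp (real m * (\<epsilon> / 8 * L - (1 + \<epsilon> / 2) * (1 - \<epsilon> / 8) * L))"
    proof -
      have "\<theta> * real t \<le> \<theta> * (\<epsilon> / (8 * \<theta>) * L)" using t \<theta>0 by (intro mult_left_mono) auto
      hence "\<theta> * real t \<le> \<epsilon> / 8 * L" using \<theta>0 by simp
      hence "real m * (\<theta> * real t) \<le> real m * (\<epsilon> / 8 * L)" by (intro mult_left_mono) auto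
      hence 1: "\<theta> * real (t * m) \<le> real m * (\<epsilon> / 8 * L)" by (simp add: mult_ac)
      have "(1 + \<epsilon> / 2) * L = p * (2 * (1 + \<epsilon> / 2) * L / p) / 2" using p by simp
      also have "\<dots> \<le> p * (real m - 1) / 2" using m1 p by (intro divide_right_mono mult_left_mono) auto
      finally have "(1 + \<epsilon> / 2) * L * (1 - \<epsilon> / 8) \<le> p * (real m - 1) / 2 * (1 - \<epsilon> / 8)"
        using \<epsilon> by (intro mult_right_mono) auto
      hence "real m * ((1 + \<epsilon> / 2) * L * (1 - \<epsilon> / 8)) \<le> real m * (p * (real m - 1) / 2 * (1 - \<epsilon> / 8))"
        by (intro mult_left_mono) auto
      also have "\<dots> = p * (1 - exp (- \<theta>)) * real (card (all_edges S))"
        using finS S by (simp add: card_all_edges real_choose_two e\<theta>)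
      finally have 2: "real m * ((1 + \<epsilon> / 2) * (1 - \<epsilon> / 8) * L) \<le> p * (1 - exp (- \<theta>)) * real (card (all_edges S))"
        by (simp add: mult_ac)
      show ?thesis using 1 2 by (simp add: right_diff_distrib)
    qed
    finally show "expect p I (\<lambda>F. of_bool (card (F \<inter> all_edges S) \<le> t * m))
        \<le> exp (real m * (\<epsilon> / 8 * L - (1 + \<epsilon> / 2) * (1 - \<epsilon> / 8) * L))" .
  qed
  also have "\<dots> = real (n choose m) * exp (real m * (\<epsilon> / 8 * L - (1 + \<epsilon> / 2) * (1 - \<epsilon> / 8) * L))"
    by (simp add: \<S>_def n_subsets)
  also have "\<dots> \<le> exp (real m * L) * exp (real m * (\<epsilon> / 8 * L - (1 + \<epsilon> / 2) * (1 - \<epsilon> / 8) * L))"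
  proof (intro mult_right_mono)
    have "real (n choose m) \<le> (exp 1 * real n / real m) ^ m" using mpos by (intro binomial_le_exp_power) auto
    also have "\<dots> \<le> d ^ m"
    proof (intro power_mono)
      \<comment> \<open>The lower bound \<open>3 / 2\<close> on \<open>L\<close> serves to make
        \<open>2 * L\<close> exceed \<open>exp 1\<close>.\<close>
      have "exp 1 * real n \<le> 3 * real n" using exp_le by (intro mult_right_mono) auto
      also have "\<dots> \<le> (2 * L) * real n" using L by (intro mult_right_mono) auto
      also have "\<dots> = d * (2 * L / p)" using p by (simp add: dn)
      also have "\<dots> \<le> d * real m" using m2 d by (intro mult_left_mono) auto
      finally show "exp 1 * real n / real m \<le> d" using mpos by (simp add: field_simps)
    qed auto
    also have "d ^ m = exp L ^ m" using d by (simp add: L_def)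
    also have "\<dots> = exp (real m * L)" by (simp only: exp_of_nat_mult)
    finally show "real (n choose m) \<le> exp (real m * L)" .
  qed auto
  also have "\<dots> = exp (real m * L * (1 + \<epsilon> / 8 - (1 + \<epsilon> / 2) * (1 - \<epsilon> / 8)))"
    by (simp add: algebra_simps flip: exp_add)
  also have "\<dots> \<le> exp (- (\<epsilon> / 8 / p))"
  proof -
    \<comment> \<open>The bracket equals
      \<open>- \<epsilon> / 4 + \<epsilon> * \<epsilon> / 16\<close>.\<close>
    have "\<epsilon> * \<epsilon> \<le> \<epsilon> * 1" using \<epsilon> by (intro mult_left_mono) auto
    hence "1 + \<epsilon> / 8 - (1 + \<epsilon> / 2) * (1 - \<epsilon> / 8) \<le> - (\<epsilon> / 8)" using \<epsilon> by (simp add: algebra_simps)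
    hence "real m * L * (1 + \<epsilon> / 8 - (1 + \<epsilon> / 2) * (1 - \<epsilon> / 8)) \<le> real m * L * (- (\<epsilon> / 8))"
      using L by (intro mult_left_mono) auto
    also have "\<dots> = - (\<epsilon> / 8 * (real m * L))" by simp
    also have "\<dots> \<le> - (\<epsilon> / 8 * (1 / p))"
    proof -
      have "1 / p \<le> 2 * L / p" using L p by (intro divide_right_mono) auto
      hence "1 / p * 1 \<le> real m * L" using m2 L by (intro mult_mono) auto
      hence "\<epsilon> / 8 * (1 / p) \<le> \<epsilon> / 8 * (real m * L)" using \<epsilon> by (intro mult_left_mono) auto
      thus ?thesis by simp
    qed
    finally show ?thesis by simp
  qed
  finally show ?thesis by (simp add: I_def)
qed

section \<open>Choice of the constants and passage to the limit\<close>

lemma large_degree_conditions: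
  fixes x :: real
  assumes "0 < x"
  shows "eventually (\<lambda>d::real. 1 < d \<and> 3 / 2 \<le> ln d \<and> 2 \<le> d * ln d
    \<and> 12 * d powr (3/4) \<le> x * d / (4 * ln d)
    \<and> 3 \<le> x * (d / (2 * ln d)) \<and> 1 \<le> d / (10 * ln d)
    \<and> 2 * d powr (- 1/4) \<le> 1
    \<and> 2 * exp 1 * ln d * exp (- x * ln d) \<le> exp (- 1)
    \<and> exp 3 * (4 * (ln d)\<^sup>2 / d) \<le> 2
    \<and> 500 * (ln d)\<^sup>2 \<le> sqrt d
    \<and> exp 3 * (4 * (ln d)\<^sup>2) + 6 * d * exp (- sqrt d) \<le> sqrt d
    \<and> sqrt d * (4 * (ln d)\<^sup>2 / d) \<le> exp (- 6)) at_top"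
  \<comment> \<open>Apart from simple lower bounds on \<open>d\<close>, powers of
    \<open>ln d\<close> compete with positive powers of \<open>d\<close>. As \<open>p\<close> does
    not occur, the resulting \<open>d0\<close> depends on \<epsilon> only.\<close>
  using assms by (intro eventually_conj; real_asymp)

lemma small_edge_probability_conditions:
  fixes x \<epsilon> :: real
  assumes "0 < x" "0 < \<epsilon>"
  shows "eventually (\<lambda>p. p \<le> 1 / 2 \<and> p \<le> x\<^sup>2 / 8 \<and> 2 * p \<le> x \<and> 2 * p \<le> exp (- 6) \<and> 2 * p \<le> \<epsilon>) (at_right 0)"
  using assms by (intro eventually_conj; real_asymp)

theorem theorem3:
  fixes \<epsilon> :: real
  assumes "\<epsilon> > 0"
  shows "\<exists>(d0::real) (\<tau>::real). \<tau> > 0 \<and>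
    (\<forall>(p :: nat \<Rightarrow> real) (d :: nat \<Rightarrow> real) (t :: nat \<Rightarrow> nat).
       (\<forall>n\<ge>1. 0 < p n \<and> p n < 1) \<longrightarrow>
       p \<in> o(\<lambda>_. 1) \<longrightarrow>
       (\<forall>n. d n = real n * p n) \<longrightarrow>
       (\<forall>\<^sub>F n in sequentially. d n \<ge> d0) \<longrightarrow>
       (\<forall>\<^sub>F n in sequentially. real (t n) \<le> \<tau> * ln (d n)) \<longrightarrow>
       (\<lambda>n. measure_pmf.prob (gnp n (p n))
          {E. (1 - \<epsilon>) * (d n / (2 * ln (d n))) \<le> real (t_improper_chromatic (t n) {1..n} E) \<and>
              real (t_improper_chromatic (t n) {1..n} E) \<le> (1 + \<epsilon>) * (d n / (2 * ln (d n)))})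
         \<longlonglongrightarrow> 1)"
proof -
  \<comment> \<open>The lower tail requires at most \<open>1 / 2\<close>, and the claim for a
    smaller value is stronger.\<close>
  define \<delta> where "\<delta> = min \<epsilon> (1 / 2)"
  have \<delta>: "0 < \<delta>" "\<delta> \<le> 1 / 2" "\<delta> \<le> \<epsilon>" using assms by (auto simp: \<delta>_def)
  \<comment> \<open>The surplus over \<open>q\<close> is \<open>8 * x\<close> in \<open>k\<close>,
    \<open>x\<close> in \<open>2 * h\<close>, and one more \<open>x\<close> for the roundings, which
    cost at most 3.\<close>
  define x where "x = \<delta> / 10"
  have x: "0 < x" "x \<le> 1 / 20" using \<delta> by (auto simp: x_def)
  define \<theta> where "\<theta> = ln (8 / \<delta>)"
  have \<theta>: "0 < \<theta>" using \<delta> by (simp add: \<theta>_def)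
  define \<tau> where "\<tau> = \<delta> / (8 * \<theta>)"
  have \<tau>: "0 < \<tau>" using \<delta> \<theta> by (simp add: \<tau>_def)
  obtain d0 :: real where d0: "\<And>d. d \<ge> d0 \<Longrightarrow> 1 < d \<and> 3 / 2 \<le> ln d \<and> 2 \<le> d * ln d
    \<and> 12 * d powr (3/4) \<le> x * d / (4 * ln d)
    \<and> 3 \<le> x * (d / (2 * ln d)) \<and> 1 \<le> d / (10 * ln d)
    \<and> 2 * d powr (- 1/4) \<le> 1
    \<and> 2 * exp 1 * ln d * exp (- x * ln d) \<le> exp (- 1)
    \<and> exp 3 * (4 * (ln d)\<^sup>2 / d) \<le> 2
    \<and> 500 * (ln d)\<^sup>2 \<le> sqrt d
    \<and> exp 3 * (4 * (ln d)\<^sup>2) + 6 * d * exp (- sqrt d) \<le> sqrt d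
    \<and> sqrt d * (4 * (ln d)\<^sup>2 / d) \<le> exp (- 6)"
    using large_degree_conditions[OF x(1)] unfolding eventually_at_top_linorder by blast
  \<comment> \<open>A bound for a single graph whose error depends on \<open>p\<close> alone;
    convergence then follows from \<open>p\<close> tending to 0 from the right.\<close>
  have main: "1 - (exp (- (\<delta> / 8 / p)) + (2 * exp (- (1 / p)) + 6 * p)) \<le> measure_pmf.prob (gnp n p)
      {E. (1 - \<epsilon>) * (d / (2 * ln d)) \<le> real (t_improper_chromatic t {1..n} E) \<and>
          real (t_improper_chromatic t {1..n} E) \<le> (1 + \<epsilon>) * (d / (2 * ln d))}"
    if p: "0 < p" and ps: "p \<le> 1 / 2 \<and> p \<le> x\<^sup>2 / 8 \<and> 2 * p \<le> x \<and> 2 * p \<le> exp (- 6) \<and> 2 * p \<le> \<delta>"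
      and dn: "d = real n * p" and dd: "d0 \<le> d" and t: "real t \<le> \<tau> * ln d"
    for p d :: real and n t :: nat
  proof -
    define L where "L = ln d"
    note c = d0[OF dd, folded L_def]
    have d: "1 < d" and L: "3 / 2 \<le> L" using c by auto
    define q where "q = d / (2 * L)"
    have q0: "0 < q" using d L by (simp add: q_def)
    define k where "k = nat \<lceil>(1 + 8 * x) * q\<rceil>"
    define h where "h = nat \<lceil>x * q / 2\<rceil>"
    have k_ge: "(1 + 8 * x) * q \<le> real k" unfolding k_def by linarith
    have k_le: "real k \<le> (1 + 8 * x) * q + 1" unfolding k_def using x q0 by (simp add: of_nat_ceiling)
    have h_ge: "x * q / 2 \<le> real h" unfolding h_def by linarith
    have h_le: "real h \<le> x * q / 2 + 1" unfolding h_def using x q0 by (simp add: of_nat_ceiling)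
    have xq: "3 \<le> x * q" using c by (simp add: q_def)
    have "1 \<le> q / 5" using c by (simp add: q_def)
    have "x * q \<le> 1 / 20 * q" using x q0 by (intro mult_right_mono) auto
    have k_le2: "real k \<le> d / L"
    proof -
      have "(1 + 8 * x) * q + 1 = q + 8 * (x * q) + 1" by (simp add: algebra_simps)
      also have "\<dots> \<le> 2 * q" using \<open>x * q \<le> 1 / 20 * q\<close> \<open>1 \<le> q / 5\<close> by linarith
      also have "2 * q = d / L" using L by (simp add: q_def)
      finally show ?thesis using k_le by linarith
    qed
    have kh: "real (k + 2 * h) \<le> (1 + \<epsilon>) * q"
    proof -
      have "real (k + 2 * h) \<le> (1 + 8 * x) * q + 1 + 2 * (x * q / 2 + 1)" using k_le h_le by simp
      also have "\<dots> = q + 9 * (x * q) + 3" by (simp add: algebra_simps)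
      also have "\<dots> \<le> q + 10 * (x * q)" using xq by linarith
      also have "\<dots> = (1 + \<delta>) * q" by (simp add: x_def algebra_simps)
      also have "\<dots> \<le> (1 + \<epsilon>) * q" using \<delta> q0 by (intro mult_right_mono) auto
      finally show ?thesis .
    qed
    define I where "I = all_edges {1..n}"
    define X where "X = (\<lambda>F. t_improper_chromatic t {1..n} F)"
    have small: "expect p I (\<lambda>F. of_bool (real (X F) < (1 - \<delta>) * q)) \<le> exp (- (\<delta> / 8 / p))"
      unfolding I_def X_def q_def
      by (rule prob_chromatic_small[OF dn p _ _ _ _ d L_def L \<theta>_def]) (use ps \<delta> t in \<open>auto simp: \<tau>_def L_def\<close>)
    have large: "expect p I (\<lambda>F. of_bool (k + 2 * h < X F)) \<le> 2 * exp (- (1 / p)) + 6 * p"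
      unfolding I_def X_def
    proof (rule prob_chromatic_large[OF dn p _ x(1) _ _ _ _ d L_def])
      show "(1 + 8 * x) * d / (2 * L) \<le> real k" using k_ge by (simp add: q_def)
      have "x * q / 2 = x * d / (4 * L)" by (simp add: q_def)
      thus "12 * d powr (3 / 4) \<le> real h" using h_ge c by linarith
    qed (use ps x k_le2 c in auto)
    define A where "A = {E. (1 - \<epsilon>) * q \<le> real (X E) \<and> real (X E) \<le> (1 + \<epsilon>) * q}"
    have finI: "finite I" by (simp add: I_def finite_all_edges)
    have "1 = expect p I (\<lambda>_. 1)" using finI by (simp add: expect_const)
    also have "\<dots> \<le> expect p I (\<lambda>F. of_bool (F \<in> A) + (of_bool (real (X F) < (1 - \<delta>) * q) + of_bool (k + 2 * h < X F)))"
    proof (intro expect_mono)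
      fix F
      have "F \<in> A" if "\<not> real (X F) < (1 - \<delta>) * q" "\<not> k + 2 * h < X F"
      proof -
        have "(1 - \<epsilon>) * q \<le> (1 - \<delta>) * q" using \<delta> q0 by (intro mult_right_mono) auto
        moreover have "real (X F) \<le> real (k + 2 * h)" using that(2) by (simp only: not_less of_nat_le_iff)
        ultimately show ?thesis using that(1) kh by (simp only: A_def mem_Collect_eq) linarith
      qed
      thus "1 \<le> (of_bool (F \<in> A) + (of_bool (real (X F) < (1 - \<delta>) * q) + of_bool (k + 2 * h < X F)) :: real)"
        by auto
    qed (use p ps in auto)
    also have "\<dots> \<le> expect p I (\<lambda>F. of_bool (F \<in> A)) + (exp (- (\<delta> / 8 / p)) + (2 * exp (- (1 / p)) + 6 * p))"
      unfolding expect_add using small large by (intro add_mono) auto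
    also have "expect p I (\<lambda>F. of_bool (F \<in> A)) = measure_pmf.prob (gnp n p) A"
      unfolding I_def using p ps by (intro prob_gnp[symmetric]) auto
    finally show ?thesis unfolding A_def q_def X_def L_def by linarith
  qed
  show ?thesis
  proof (rule exI[of _ d0], rule exI[of _ \<tau>], intro conjI \<tau> allI impI)
    fix p d :: "nat \<Rightarrow> real" and t :: "nat \<Rightarrow> nat"
    assume p: "\<forall>n\<ge>1. 0 < p n \<and> p n < 1" and po: "p \<in> o(\<lambda>_. 1)" and d: "\<forall>n. d n = real n * p n"
      and dd: "\<forall>\<^sub>F n in sequentially. d n \<ge> d0" and t: "\<forall>\<^sub>F n in sequentially. real (t n) \<le> \<tau> * ln (d n)"
    let ?P = "\<lambda>n. measure_pmf.prob (gnp n (p n))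
          {E. (1 - \<epsilon>) * (d n / (2 * ln (d n))) \<le> real (t_improper_chromatic (t n) {1..n} E) \<and>
              real (t_improper_chromatic (t n) {1..n} E) \<le> (1 + \<epsilon>) * (d n / (2 * ln (d n)))}"
    have ev0: "\<forall>\<^sub>F n in sequentially. 0 < p n"
      using eventually_ge_at_top[of 1] by eventually_elim (use p in auto)
    have "p \<longlonglongrightarrow> 0" using smalloD_tendsto[OF po] by simp
    hence lim: "filterlim p (at_right 0) sequentially"
      using ev0 by (auto simp: filterlim_at elim: eventually_mono)
    have evs: "\<forall>\<^sub>F n in sequentially. p n \<le> 1 / 2 \<and> p n \<le> x\<^sup>2 / 8 \<and> 2 * p n \<le> x \<and> 2 * p n \<le> exp (- 6) \<and> 2 * p n \<le> \<delta>"
      using small_edge_probability_conditions[OF x(1) \<delta>(1)] lim by (rule eventually_compose_filterlim)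
    have low: "\<forall>\<^sub>F n in sequentially. 1 - (exp (- (\<delta> / 8 / p n)) + (2 * exp (- (1 / p n)) + 6 * p n)) \<le> ?P n"
      using ev0 evs dd t by eventually_elim (use d in \<open>intro main; auto\<close>)
    have "((\<lambda>p. 1 - (exp (- (\<delta> / 8 / p)) + (2 * exp (- (1 / p)) + 6 * p))) \<longlongrightarrow> 1) (at_right 0)"
      using \<delta>(1) by real_asymp
    from filterlim_compose[OF this lim]
    have lim1: "(\<lambda>n. 1 - (exp (- (\<delta> / 8 / p n)) + (2 * exp (- (1 / p n)) + 6 * p n))) \<longlonglongrightarrow> 1" .
    show "?P \<longlonglongrightarrow> 1"
      by (rule tendsto_sandwich[OF low _ lim1 tendsto_const]) (simp add: always_eventually)
  qed
qed

end
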